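(* Let $\Omega=[0,1]^D$ and let $A:\mathcal{M}(\Omega)\to\mathbb{R}^M$ be weak-$*$-continuous, i.e. $(A\mu)_m=\int_\Omega a_m\,d\mu$ with $a_m\in\mathcal{C}_0(\Omega)$ for $1\le m\le M$. Let $f:\mathbb{R}^M\to\mathbb{R}\cup\{+\infty\}$ be convex and lower semi-continuous with $\operatorname{int}(\operatorname{dom}(f))\ne\emptyset$. Assume that $\mathcal{J}(\mu)=\|\mu\|_{\mathcal{M}}+f(A\mu)$ is coercive, i.e. $\mathcal{J}(\mu)\to\infty$ when $\|\mu\|_{\mathcal{M}}\to\infty$. Run the adaptive refinement algorithm (described in the context, without stopping) from an initial cell partition $\Omega_0$ with vertex set $\mathcal{V}_0$, and assume that (a) there exists $\mu\in\mathcal{M}(\mathcal{V}_0)$ with $A\mu\in\operatorname{int}(\operatorname{dom}(f))$; (b) for every $k$, the candidate cells satisfy $X_k\subset\bigcup_{\omega\in\Omega_k^\star}\omega$, where $X_k$ is the set of local maximizers $x\in\Omega$ of $|A^*q_k|$ with $|A^*q_k(x)|\ge 1$. Then the sequences $(\mu_k)_{k\in\mathbb{N}}$ and $(q_k)_{k\in\mathbb{N}}$ of the algorithm are well-defined (the discretized primal and dual problems all have solutions). They contain subsequences that converge (weak-$*$ for $\mu_k$, in $\mathbb{R}^M$ for $q_k$) to a solution $\mu^\star$ of $(\mathcal{P}(\Omega))$ and a solution $q^\star$ of $(\mathcal{D}(\Omega))$ respectively, and also in optimal function value, i.e. along these subsequences $\mathcal{J}(\mu_k)\to\mathcal{J}(\mu^\star)$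 and $f^*(q_k)\to f^*(q^\star)$. If the primal solution (respectively the dual solution) is unique, then the whole sequence $(\mu_k)$ (respectively $(q_k)$) converges to it.
   Context: $\mathcal{M}(\Omega)$ is the space of Radon measures of bounded total variation on $\Omega$, with total variation norm $\|\cdot\|_{\mathcal{M}}$; $\mathcal{C}_0(\Omega)$ is the space of continuous functions on $\Omega$ vanishing on the boundary, and weak-$*$ convergence is with respect to the duality with $\mathcal{C}_0(\Omega)$. For $\mathcal{V}\subseteq\Omega$, $\mathcal{M}(\mathcal{V})$ is the set of measures supported on $\mathcal{V}$. $A^*q=\sum_{m=1}^M q_m a_m$, $\|A^*q\|_{L^\infty(\mathcal{V})}=\sup_{x\in\mathcal{V}}|A^*q(x)|$, and $f^*$ is the Fenchel conjugate of $f$. Problems: $(\mathcal{P}(\mathcal{V}))$: $\inf_{\mu\in\mathcal{M}(\mathcal{V})}\mathcal{J}(\mu)$. $(\mathcal{D}(\mathcal{V}))$: $\sup\{-f^*(q): q\in\mathbb{R}^M,\ \|A^*q\|_{L^\infty(\mathcal{V})}\le 1\}$. Cells: a dyadic cell is a set $\omega=x+2^{-j}[0,1]^D$ with $j\ge 0$ an integer and $x\in(2^{-j}\{0,1,\dots,2^j-1\})^D$; $|\omega|=2^{-j}$ is its edge-length and $\operatorname{vert}(\omega)$ its set of vertices. A cell partition is a finite collection of cells whose union is $\Omega$ and such that two distinct cells have an intersection of zero Lebesgue measure. Adaptive refinement algorithm: start from a cell partition $\Omega_0$ (e.g. $\{\Omega\}$). At step $k$, let $\mathcal{V}_k=\bigcup_{\omega\in\Omega_k}\operatorname{vert}(\omega)$;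 let $\mu_k$ be a solution of $(\mathcal{P}(\mathcal{V}_k))$ and $q_k$ a solution of $(\mathcal{D}(\mathcal{V}_k))$; choose a set of candidate cells $\Omega_k^\star\subset\Omega_k$; obtain $\Omega_{k+1}$ from $\Omega_k$ by subdividing each cell of $\Omega_k^\star$ of largest diameter (among the cells of $\Omega_k^\star$) into $2^D$ equal cells. If $\Omega_k^\star=\emptyset$ nothing is subdivided and $\Omega_{k+1}=\Omega_k$. *)

theory Defs
  imports "HOL-Analysis.Analysis"
begin

section \<open>Radon measures of bounded variation\<close>

text \<open>
  A signed measure is a real-valued set function. Its values on non-Borel sets are
  normalised to 0, so that equality of set functions is equality of measures. The equation
  \<open>\<mu> {} = 0\<close> follows from the convergence of the series for the constant empty family.
\<close>

definition signed_borel_measure :: "('a::topological_space set \<Rightarrow> real) \<Rightarrow> bool" where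
  "signed_borel_measure \<mu> \<longleftrightarrow>
     (\<forall>B. B \<notin> sets borel \<longrightarrow> \<mu> B = 0) \<and>
     (\<forall>F :: nat \<Rightarrow> 'a set. range F \<subseteq> sets borel \<longrightarrow> disjoint_family F \<longrightarrow>
        (\<lambda>n. \<mu> (F n)) sums \<mu> (\<Union>n. F n))"

definition total_variation :: "('a::topological_space set \<Rightarrow> real) \<Rightarrow> ereal" where
  "total_variation \<mu> =
     (SUP P \<in> {P. finite P \<and> P \<subseteq> sets borel \<and> disjoint P}. ereal (\<Sum>B\<in>P. \<bar>\<mu> B\<bar>))"

text \<open>
  \<open>radon_measures V\<close> is the set of measures supported on \<open>V\<close>. They are set functions on the
  ambient space that vanish off \<open>V\<close>, hence measures on \<open>V\<close> are also measures on every larger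
  set. Finite Borel measures on a Euclidean space are automatically regular, so no regularity
  condition appears. Only closed sets \<open>V\<close> are used, for which vanishing
  off \<open>V\<close> says that the support is contained in \<open>V\<close>.
\<close>

definition radon_measures :: "'a::euclidean_space set \<Rightarrow> ('a set \<Rightarrow> real) set" where
  "radon_measures V =
     {\<mu>. signed_borel_measure \<mu> \<and> total_variation \<mu> < \<infinity> \<and>
         (\<forall>B\<in>sets borel. B \<inter> V = {} \<longrightarrow> \<mu> B = 0)}"

text \<open>
  The upper variation of \<open>\<mu>\<close> is the positive part of its Jordan decomposition, and the upper
  variation of \<open>-\<mu>\<close> is the negative part. In the supremum, \<open>ennreal\<close> truncates
  negative values to 0, which is the value at \<open>C = {}\<close>.
\<close>

definition upper_variation :: "('a::topological_space set \<Rightarrow> real) \<Rightarrow> 'a measure" where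
  "upper_variation \<mu> =
     measure_of UNIV (sets borel) (\<lambda>B. SUP C \<in> {C \<in> sets borel. C \<subseteq> B}. ennreal (\<mu> C))"

definition signed_integral ::
    "'a::topological_space set \<Rightarrow> ('a set \<Rightarrow> real) \<Rightarrow> ('a \<Rightarrow> real) \<Rightarrow> real" where
  "signed_integral S \<mu> \<phi> =
     set_lebesgue_integral (upper_variation \<mu>) S \<phi> -
     set_lebesgue_integral (upper_variation (\<lambda>B. - \<mu> B)) S \<phi>"

text \<open>Only the restriction of the functions to \<open>S\<close> matters.\<close>

definition C0_functions :: "'a::topological_space set \<Rightarrow> ('a \<Rightarrow> real) set" where
  "C0_functions S = {\<phi>. continuous_on S \<phi> \<and> (\<forall>x\<in>frontier S. \<phi> x = 0)}"

definition weak_star_converges ::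
    "'a::topological_space set \<Rightarrow> (nat \<Rightarrow> 'a set \<Rightarrow> real) \<Rightarrow> ('a set \<Rightarrow> real) \<Rightarrow> bool" where
  "weak_star_converges S \<mu>s \<mu> \<longleftrightarrow>
     (\<forall>\<phi>\<in>C0_functions S. (\<lambda>k. signed_integral S (\<mu>s k) \<phi>) \<longlonglongrightarrow> signed_integral S \<mu> \<phi>)"


section \<open>Extended-real-valued convex functions\<close>

definition effective_domain :: "('a \<Rightarrow> ereal) \<Rightarrow> 'a set" where
  "effective_domain f = {x. f x < \<infinity>}"

text \<open>
  The next notion is meant for functions that do not take the value \<open>-\<infinity>\<close>; the cases
  \<open>t = 0\<close> and \<open>t = 1\<close> are harmless because \<open>0 * \<infinity> = 0\<close> in \<open>ereal\<close>.
\<close>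

definition ereal_convex :: "('a::real_vector \<Rightarrow> ereal) \<Rightarrow> bool" where
  "ereal_convex f \<longleftrightarrow>
     (\<forall>x y. \<forall>t\<in>{0..1}.
        f ((1 - t) *\<^sub>R x + t *\<^sub>R y) \<le> ereal (1 - t) * f x + ereal t * f y)"

definition lower_semicontinuous :: "('a::topological_space \<Rightarrow> ereal) \<Rightarrow> bool" where
  "lower_semicontinuous f \<longleftrightarrow> (\<forall>x. f x \<le> Liminf (at x) f)"

definition fenchel_conjugate :: "('a::real_inner \<Rightarrow> ereal) \<Rightarrow> 'a \<Rightarrow> ereal" where
  "fenchel_conjugate f q = (SUP y. ereal (q \<bullet> y) - f y)"


section \<open>The primal and dual problems\<close>

definition unit_cube :: "(real^'d) set" where
  "unit_cube = cbox 0 1"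

definition measurement ::
    "('m \<Rightarrow> real^'d \<Rightarrow> real) \<Rightarrow> ((real^'d) set \<Rightarrow> real) \<Rightarrow> real^'m" where
  "measurement a \<mu> = (\<chi> m. signed_integral unit_cube \<mu> (a m))"

definition adjoint_measurement ::
    "('m::finite \<Rightarrow> real^'d \<Rightarrow> real) \<Rightarrow> real^'m \<Rightarrow> real^'d \<Rightarrow> real" where
  "adjoint_measurement a q x = (\<Sum>m\<in>UNIV. q $ m * a m x)"

definition objective ::
    "(real^'m \<Rightarrow> ereal) \<Rightarrow> ('m \<Rightarrow> real^'d \<Rightarrow> real) \<Rightarrow> ((real^'d) set \<Rightarrow> real) \<Rightarrow> ereal" where
  "objective f a \<mu> = total_variation \<mu> + f (measurement a \<mu>)"

definition coercive_objective ::
    "(real^'m \<Rightarrow> ereal) \<Rightarrow> ('m \<Rightarrow> real^'d \<Rightarrow> real) \<Rightarrow> bool" where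
  "coercive_objective f a \<longleftrightarrow>
     (\<forall>C::real. \<exists>R::real. \<forall>\<mu>\<in>radon_measures unit_cube.
        ereal R \<le> total_variation \<mu> \<longrightarrow> ereal C \<le> objective f a \<mu>)"

definition primal_value ::
    "(real^'m \<Rightarrow> ereal) \<Rightarrow> ('m \<Rightarrow> real^'d \<Rightarrow> real) \<Rightarrow> (real^'d) set \<Rightarrow> ereal" where
  "primal_value f a V = (INF \<mu>\<in>radon_measures V. objective f a \<mu>)"

definition primal_solution ::
    "(real^'m \<Rightarrow> ereal) \<Rightarrow> ('m \<Rightarrow> real^'d \<Rightarrow> real) \<Rightarrow> (real^'d) set \<Rightarrow>
     ((real^'d) set \<Rightarrow> real) \<Rightarrow> bool" where
  "primal_solution f a V \<mu> \<longleftrightarrow>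
     \<mu> \<in> radon_measures V \<and> objective f a \<mu> = primal_value f a V"

definition sup_norm_on :: "'a set \<Rightarrow> ('a \<Rightarrow> real) \<Rightarrow> ereal" where
  "sup_norm_on V g = (SUP x\<in>V. ereal \<bar>g x\<bar>)"

definition dual_feasible ::
    "('m::finite \<Rightarrow> real^'d \<Rightarrow> real) \<Rightarrow> (real^'d) set \<Rightarrow> (real^'m) set" where
  "dual_feasible a V = {q. sup_norm_on V (adjoint_measurement a q) \<le> 1}"

definition dual_value ::
    "(real^'m::finite \<Rightarrow> ereal) \<Rightarrow> ('m \<Rightarrow> real^'d \<Rightarrow> real) \<Rightarrow> (real^'d) set \<Rightarrow> ereal" where
  "dual_value f a V = (SUP q\<in>dual_feasible a V. - fenchel_conjugate f q)"

definition dual_solution ::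
    "(real^'m::finite \<Rightarrow> ereal) \<Rightarrow> ('m \<Rightarrow> real^'d \<Rightarrow> real) \<Rightarrow> (real^'d) set \<Rightarrow> real^'m \<Rightarrow> bool" where
  "dual_solution f a V q \<longleftrightarrow>
     q \<in> dual_feasible a V \<and> - fenchel_conjugate f q = dual_value f a V"


section \<open>Dyadic cells and adaptive refinement\<close>

definition dyadic_cube :: "nat \<Rightarrow> real^'d \<Rightarrow> (real^'d) set" where
  "dyadic_cube j x = cbox x (x + (1 / 2 ^ j) *\<^sub>R 1)"

definition dyadic_cells :: "(real^'d) set set" where
  "dyadic_cells = {dyadic_cube j x | j x. \<forall>i. \<exists>n::nat. n < 2 ^ j \<and> x $ i = real n / 2 ^ j}"

text \<open>
  In the next two definitions \<open>j\<close> and \<open>x\<close> are determined by the cell \<open>\<omega>\<close>.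
\<close>

definition cell_vertices :: "(real^'d) set \<Rightarrow> (real^'d) set" where
  "cell_vertices \<omega> =
     {v. \<exists>j x. \<omega> = dyadic_cube j x \<and> (\<forall>i. v $ i = x $ i \<or> v $ i = x $ i + 1 / 2 ^ j)}"

definition subcells :: "(real^'d) set \<Rightarrow> (real^'d) set set" where
  "subcells \<omega> =
     {dyadic_cube (Suc j) v | j x v.
        \<omega> = dyadic_cube j x \<and> (\<forall>i. v $ i = x $ i \<or> v $ i = x $ i + 1 / 2 ^ Suc j)}"

definition cell_partition :: "(real^'d) set set \<Rightarrow> bool" where
  "cell_partition W \<longleftrightarrow>
     finite W \<and> W \<subseteq> dyadic_cells \<and> \<Union>W = unit_cube \<and>
     (\<forall>\<omega>\<in>W. \<forall>\<omega>'\<in>W. \<omega> \<noteq> \<omega>' \<longrightarrow> negligible (\<omega> \<inter> \<omega>'))"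

definition partition_vertices :: "(real^'d) set set \<Rightarrow> (real^'d) set" where
  "partition_vertices W = (\<Union>\<omega>\<in>W. cell_vertices \<omega>)"

definition largest_cells :: "(real^'d) set set \<Rightarrow> (real^'d) set set" where
  "largest_cells C = {\<omega>\<in>C. \<forall>\<omega>'\<in>C. diameter \<omega>' \<le> diameter \<omega>}"

definition refine :: "(real^'d) set set \<Rightarrow> (real^'d) set set \<Rightarrow> (real^'d) set set" where
  "refine W C = (W - largest_cells C) \<union> (\<Union>\<omega>\<in>largest_cells C. subcells \<omega>)"

text \<open>
  One iteration: from the partition \<open>W\<close>, with the primal and dual solutions \<open>\<mu>\<close> and \<open>q\<close> on its
  vertices and the set \<open>C\<close> of candidate cells, to the partition \<open>W'\<close>.
\<close>

definition refinement_step ::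
    "(real^'m::finite \<Rightarrow> ereal) \<Rightarrow> ('m \<Rightarrow> real^'d \<Rightarrow> real) \<Rightarrow> (real^'d) set set \<Rightarrow>
     ((real^'d) set \<Rightarrow> real) \<Rightarrow> real^'m \<Rightarrow> (real^'d) set set \<Rightarrow> (real^'d) set set \<Rightarrow> bool" where
  "refinement_step f a W \<mu> q C W' \<longleftrightarrow>
     primal_solution f a (partition_vertices W) \<mu> \<and>
     dual_solution f a (partition_vertices W) q \<and>
     C \<subseteq> W \<and> W' = refine W C"

text \<open>Neighbourhoods are taken relative to the cube.\<close>

definition large_local_maximizers ::
    "('m::finite \<Rightarrow> real^'d \<Rightarrow> real) \<Rightarrow> real^'m \<Rightarrow> (real^'d) set" where
  "large_local_maximizers a q =
     {x\<in>unit_cube.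
        (\<forall>\<^sub>F y in at x within unit_cube.
           \<bar>adjoint_measurement a q y\<bar> \<le> \<bar>adjoint_measurement a q x\<bar>) \<and>
        1 \<le> \<bar>adjoint_measurement a q x\<bar>}"

end

theory Submission
  imports Defs "HOL-Probability.Giry_Monad" "HOL-Probability.Helly_Selection"
begin

text \<open>
  Write \<open>V k\<close> for the vertices of the \<open>k\<close>-th partition, \<open>J\<close> for the objective and \<open>A*q\<close> for
  \<open>adjoint_measurement a q\<close>. A measure supported on the finite set \<open>V k\<close> is a finite vector of
  weights, so the discretized problems are finite-dimensional. Their primal problem has a
  minimizer because \<open>J\<close> is coercive and lower semicontinuous. Separating the epigraph of \<open>f\<close>
  from a convex set below it gives strong duality and a dual solution; the Slater point, which
  stays admissible because vertices are never removed, rules out a vertical hyperplane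
  (\<open>finite_duality\<close>). Hence \<open>J (\<mu> k) = - f* (q k)\<close>. Write \<open>p k\<close> for this common optimal value;
  it decreases in \<open>k\<close>.

  Coercivity bounds \<open>\<mu> k\<close>, so a subsequence converges weakly-* to some \<open>\<nu>\<close> with \<open>J \<nu> \<le> lim p\<close>
  (\<open>primal_cluster_point\<close>). In particular \<open>lim p\<close> is finite. Since \<open>f\<close> is bounded near the
  Slater point, \<open>f*\<close> grows linearly on the dual feasible sets, so \<open>q k\<close> is bounded, and a
  subsequence has a limit \<open>q'\<close> with \<open>- f* q' \<ge> lim p\<close> (\<open>dual_cluster_point\<close>).

  The refinement rule is what makes \<open>q'\<close> feasible on the whole cube. If \<open>|A*q k|\<close> reaches 1, its
  maximizer lies in a candidate cell, at the vertices of which \<open>|A*q k| \<le> 1\<close>. The largest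
  candidates are subdivided, and a weighted count of the cells above a given size drops whenever
  one of these cells is subdivided. So the diameters of the candidates tend to 0
  (\<open>candidate_cells_shrink\<close>). By equicontinuity \<open>|A*q k| \<le> 1 + o(1)\<close> uniformly
  (\<open>nearly_feasible\<close>).

  Weak duality on the cube now closes the circle \<open>lim p \<le> - f* q' \<le> inf J \<le> J \<nu> \<le> lim p\<close>. All of
  these are equal, so \<open>\<nu>\<close> and \<open>q'\<close> are optimal and the values converge. Applied to arbitrary
  subsequences, the same argument gives convergence of the whole sequence to a unique solution.

  The measure-theoretic ingredients are the Jordan decomposition, which turns \<open>signed_integral\<close>
  into a difference of two ordinary integrals, and weak-* sequential compactness. Compactness is
  used for measures with finite support only. Their positive and negative parts are transported
  to the unit interval along a space-filling curve, where Helly's selection theorem applies, and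
  the limits are pushed forward to the cube (\<open>weak_limit_of_atoms\<close>). The masses of the two parts
  converge, and their sum bounds the total variation of the limit.
\<close>

section \<open>Lower semicontinuity along sequences\<close>

text \<open>
  The limit inferior over \<open>at x\<close> ignores the point \<open>x\<close>, which the sequence may visit; there the
  bound is the assumption on \<open>f x\<close> itself.
\<close>

lemma lower_semicontinuous_eventually_greater:
  assumes "lower_semicontinuous f" "y \<longlonglongrightarrow> x" "c < f x"
  shows "\<forall>\<^sub>F n in sequentially. c < f (y n)"
proof -
  have "c < Liminf (at x) f"
    using assms(1,3) unfolding lower_semicontinuous_def by (meson less_le_trans)
  then have "\<forall>\<^sub>F z in at x. c < f z"
    by (rule less_LiminfD)
  then have "\<forall>\<^sub>F z in nhds x. c < f z"
    using assms(3) by (auto simp: eventually_at_filter elim: eventually_mono)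
  then show ?thesis
    using assms(2) by (rule eventually_compose_filterlim)
qed

text \<open>
  This is how the objective passes to the limit: \<open>t n\<close> stands for the total variation and \<open>y n\<close> for
  the measurement of the \<open>n\<close>-th measure. Testing with real numbers below \<open>f x\<close> treats finite and
  infinite values of \<open>f x\<close> alike.
\<close>

lemma lower_semicontinuous_sum_le_limit:
  fixes f :: "'a::topological_space \<Rightarrow> ereal" and t :: "nat \<Rightarrow> real"
  assumes "lower_semicontinuous f" and minf: "f x \<noteq> -\<infinity>"
    and "y \<longlonglongrightarrow> x" "t \<longlonglongrightarrow> s" "(\<lambda>n. ereal (t n) + f (y n)) \<longlonglongrightarrow> p"
  shows "ereal s + f x \<le> p"
proof -
  have *: "ereal (s + c) \<le> p" if "ereal c < f x" for c
  proof (rule tendsto_le[OF _ assms(5)])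
    show "(\<lambda>n. ereal (t n + c)) \<longlonglongrightarrow> ereal (s + c)"
      using assms(4) by (intro tendsto_intros)
    show "\<forall>\<^sub>F n in sequentially. ereal (t n + c) \<le> ereal (t n) + f (y n)"
      using lower_semicontinuous_eventually_greater[OF assms(1,3) that]
    proof (eventually_elim)
      case (elim n)
      then show ?case by (cases "f (y n)") auto
    qed
  qed simp
  show ?thesis
  proof (cases "f x")
    case (real r)
    have below: "ereal (s + (r - e)) \<le> p" if "e > 0" for e
      using *[of "r - e"] real that by simp
    have "ereal (s + r) \<le> p"
    proof (cases p)
      case (real p')
      have "s + r \<le> p' + e" if "e > 0" for e
        using below[OF that] real by simp
      then have "s + r \<le> p'" by (rule field_le_epsilon)
      then show ?thesis using real by simp
    qed (use below[of 1] in auto)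
    then show ?thesis using real by simp
  next
    case PInf
    have "ereal c \<le> p" for c using *[of "c - s"] PInf by simp
    then have "p = \<infinity>" by (metis ereal_top)
    then show ?thesis by simp
  qed (use minf in auto)
qed

lemma fenchel_conjugate_limit_le:
  fixes f :: "'a::real_inner \<Rightarrow> ereal"
  assumes minf: "\<And>y. f y \<noteq> -\<infinity>"
    and "q \<longlonglongrightarrow> q'" "(\<lambda>n. fenchel_conjugate f (q n)) \<longlonglongrightarrow> p"
  shows "fenchel_conjugate f q' \<le> p"
  unfolding fenchel_conjugate_def
proof (rule SUP_least)
  fix y
  show "ereal (q' \<bullet> y) - f y \<le> p"
  proof (cases "f y")
    case (real r)
    have lim: "(\<lambda>n. ereal (q n \<bullet> y - r)) \<longlonglongrightarrow> ereal (q' \<bullet> y - r)"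
      using assms(2) by (intro tendsto_intros)
    have "ereal (q n \<bullet> y - r) \<le> fenchel_conjugate f (q n)" for n
      unfolding fenchel_conjugate_def by (rule SUP_upper2[of y]) (auto simp: real)
    then have "ereal (q' \<bullet> y - r) \<le> p"
      by (intro LIMSEQ_le[OF lim assms(3)]) auto
    then show ?thesis using real by simp
  qed (use minf in auto)
qed

section \<open>The Jordan decomposition of a signed Borel measure\<close>

lemma signed_borel_measure_empty: "signed_borel_measure \<mu> \<Longrightarrow> \<mu> {} = 0"
proof -
  assume "signed_borel_measure \<mu>"
  then have "(\<lambda>n::nat. \<mu> {}) sums \<mu> (\<Union>n::nat. {})"
    unfolding signed_borel_measure_def
    by (elim conjE allE[where x = "\<lambda>_. {}"]) (simp add: disjoint_family_on_def)
  then show ?thesis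
    by (metis LIMSEQ_const_iff sums_summable summable_LIMSEQ_zero)
qed

lemma signed_borel_measure_sums:
  assumes "signed_borel_measure \<mu>" "range F \<subseteq> sets borel" "disjoint_family F"
  shows "(\<lambda>n::nat. \<mu> (F n)) sums \<mu> (\<Union>n. F n)"
  using assms unfolding signed_borel_measure_def by blast

lemma signed_borel_measure_Un:
  assumes m: "signed_borel_measure \<mu>" and "A \<in> sets borel" "B \<in> sets borel" "A \<inter> B = {}"
  shows "\<mu> (A \<union> B) = \<mu> A + \<mu> B"
proof -
  have "(\<lambda>n. \<mu> (binaryset A B n)) sums \<mu> (\<Union>n. binaryset A B n)"
    using assms by (intro signed_borel_measure_sums)
      (auto simp: range_binaryset_eq disjoint_family_on_def binaryset_def)
  moreover have "(\<lambda>n. \<mu> (binaryset A B n)) sums (\<mu> A + \<mu> B)"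
    by (rule binaryset_sums) (rule signed_borel_measure_empty[OF m])
  ultimately show ?thesis
    using sums_unique2 by (fastforce simp: UN_binaryset_eq)
qed

lemma signed_borel_measure_Diff:
  assumes m: "signed_borel_measure \<mu>" and "A \<in> sets borel" "B \<in> sets borel"
  shows "\<mu> (A - B) = \<mu> A - \<mu> (A \<inter> B)"
proof -
  have "A = (A - B) \<union> (A \<inter> B)" by auto
  then show ?thesis
    using signed_borel_measure_Un[OF m, of "A - B" "A \<inter> B"] assms by fastforce
qed

lemma signed_borel_measure_uminus:
  "signed_borel_measure \<mu> \<Longrightarrow> signed_borel_measure (\<lambda>B. - \<mu> B)"
  unfolding signed_borel_measure_def by (auto intro: sums_minus)

text \<open>
  The values on the intersection cancel, and the two set differences are disjoint.
\<close>

lemma abs_diff_le_total_variation: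
  assumes m: "signed_borel_measure \<mu>" and [measurable]: "C \<in> sets borel" "D \<in> sets borel"
  shows "ereal (\<bar>\<mu> C - \<mu> D\<bar>) \<le> total_variation \<mu>"
proof -
  have "\<mu> C - \<mu> D = \<mu> (C - D) - \<mu> (D - C)"
    using signed_borel_measure_Diff[OF m, of C D] signed_borel_measure_Diff[OF m, of D C]
    by (simp add: Int_commute)
  also have "\<bar>\<dots>\<bar> \<le> (\<Sum>B\<in>{C - D, D - C}. \<bar>\<mu> B\<bar>)"
    by (cases "C - D = D - C") (auto simp: signed_borel_measure_empty[OF m])
  finally have "ereal (\<bar>\<mu> C - \<mu> D\<bar>) \<le> ereal (\<Sum>B\<in>{C - D, D - C}. \<bar>\<mu> B\<bar>)"
    by simp
  also have "\<dots> \<le> total_variation \<mu>"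
    unfolding total_variation_def
    by (rule SUP_upper) (auto simp: disjoint_def)
  finally show ?thesis .
qed

lemma total_variation_nonneg: "0 \<le> total_variation \<mu>"
  unfolding total_variation_def by (rule SUP_upper2[of "{}"]) auto

lemma sum_abs_le_total_variation:
  "finite P \<Longrightarrow> P \<subseteq> sets borel \<Longrightarrow> disjoint P \<Longrightarrow> ereal (\<Sum>B\<in>P. \<bar>\<mu> B\<bar>) \<le> total_variation \<mu>"
  unfolding total_variation_def by (rule SUP_upper) auto

lemma total_variation_uminus [simp]: "total_variation (\<lambda>B. - \<mu> B) = total_variation \<mu>"
  unfolding total_variation_def by simp

text \<open>
  \<open>upper_variation\<close> is the \<open>measure_of\<close> this set function. The two agree on Borel sets once countable
  additivity is known.
\<close>

definition upper_value :: "('a::topological_space set \<Rightarrow> real) \<Rightarrow> 'a set \<Rightarrow> ennreal" where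
  "upper_value \<mu> B = (SUP C \<in> {C \<in> sets borel. C \<subseteq> B}. ennreal (\<mu> C))"

lemma upper_value_upper: "C \<in> sets borel \<Longrightarrow> C \<subseteq> B \<Longrightarrow> ennreal (\<mu> C) \<le> upper_value \<mu> B"
  unfolding upper_value_def by (rule SUP_upper) auto

lemma upper_value_mono: "A \<subseteq> B \<Longrightarrow> upper_value \<mu> A \<le> upper_value \<mu> B"
  unfolding upper_value_def by (rule SUP_subset_mono) auto

lemma upper_value_empty: "signed_borel_measure \<mu> \<Longrightarrow> upper_value \<mu> {} = 0"
  unfolding upper_value_def by (auto simp: signed_borel_measure_empty)

lemma upper_value_superadditive:
  assumes m: "signed_borel_measure \<mu>" and [measurable]: "A \<in> sets borel" "B \<in> sets borel" and "A \<inter> B = {}"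
  shows "upper_value \<mu> A + upper_value \<mu> B \<le> upper_value \<mu> (A \<union> B)"
proof -
  have *: "ennreal (\<mu> C) + ennreal (\<mu> D) \<le> upper_value \<mu> (A \<union> B)"
    if [measurable]: "C \<in> sets borel" "D \<in> sets borel" and "C \<subseteq> A" "D \<subseteq> B" for C D
  proof (cases "\<mu> C \<le> 0 \<or> \<mu> D \<le> 0")
    case True
    have "ennreal (\<mu> C) \<le> upper_value \<mu> (A \<union> B)" "ennreal (\<mu> D) \<le> upper_value \<mu> (A \<union> B)"
      using that by (auto intro!: upper_value_upper)
    then show ?thesis using True by (auto simp: ennreal_neg)
  next
    case False
    have "C \<inter> D = {}" using that assms(4) by auto
    then have "ennreal (\<mu> C) + ennreal (\<mu> D) = ennreal (\<mu> (C \<union> D))"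
      using False signed_borel_measure_Un[OF m that(1,2)]
      by (subst ennreal_plus[symmetric]) auto
    also have "\<dots> \<le> upper_value \<mu> (A \<union> B)"
      using that by (intro upper_value_upper) auto
    finally show ?thesis .
  qed
  have "upper_value \<mu> A + ennreal (\<mu> D) \<le> upper_value \<mu> (A \<union> B)"
    if "D \<in> sets borel" "D \<subseteq> B" for D
  proof -
    have "upper_value \<mu> A + ennreal (\<mu> D) =
        (SUP C \<in> {C \<in> sets borel. C \<subseteq> A}. ennreal (\<mu> C) + ennreal (\<mu> D))"
      unfolding upper_value_def by (subst ennreal_SUP_add_left) auto
    also have "\<dots> \<le> upper_value \<mu> (A \<union> B)"
      using * that by (intro SUP_least) auto
    finally show ?thesis .
  qed
  note this' = this
  have "upper_value \<mu> A + upper_value \<mu> B =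
      (SUP D \<in> {D \<in> sets borel. D \<subseteq> B}. upper_value \<mu> A + ennreal (\<mu> D))"
    unfolding upper_value_def[of \<mu> B] by (subst ennreal_SUP_add_right) auto
  also have "\<dots> \<le> upper_value \<mu> (A \<union> B)"
    using this' by (intro SUP_least) auto
  finally show ?thesis .
qed

text \<open>
  One inequality is finite superadditivity, since disjoint competitors can be united. For the other,
  a competitor \<open>C\<close> is cut along the sets of the family, and \<open>\<mu> C\<close> is the sum over the pieces.
\<close>

lemma countably_additive_upper_value:
  fixes \<mu> :: "'a::topological_space set \<Rightarrow> real"
  assumes m: "signed_borel_measure \<mu>"
  shows "countably_additive (sets borel) (upper_value \<mu>)"
proof (rule countably_additiveI)
  fix F :: "nat \<Rightarrow> 'a set" assume F: "range F \<subseteq> sets borel" "disjoint_family F" "(\<Union>i. F i) \<in> sets borel"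
  have [measurable]: "F i \<in> sets borel" for i using F by auto
  have fin: "(\<Sum>i<n. upper_value \<mu> (F i)) \<le> upper_value \<mu> (\<Union>i<n. F i)" for n
  proof (induction n)
    case (Suc n)
    have "(\<Sum>i<Suc n. upper_value \<mu> (F i)) \<le> upper_value \<mu> (\<Union>i<n. F i) + upper_value \<mu> (F n)"
      using Suc by (simp add: add_right_mono)
    also have "\<dots> \<le> upper_value \<mu> ((\<Union>i<n. F i) \<union> F n)"
    proof (rule upper_value_superadditive[OF m])
      show "(\<Union>i<n. F i) \<inter> F n = {}"
      proof -
        have "F i \<inter> F n = {}" if "i < n" for i
          using disjoint_family_onD[OF F(2)] that by simp
        then show ?thesis by auto
      qed
    qed auto
    finally show ?case by (simp add: lessThan_Suc Un_commute)
  qed simp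
  show "(\<Sum>i. upper_value \<mu> (F i)) = upper_value \<mu> (\<Union>i. F i)"
  proof (rule antisym)
    show "(\<Sum>i. upper_value \<mu> (F i)) \<le> upper_value \<mu> (\<Union>i. F i)"
      unfolding suminf_eq_SUP
      by (intro SUP_least order_trans[OF fin] upper_value_mono) auto
    show "upper_value \<mu> (\<Union>i. F i) \<le> (\<Sum>i. upper_value \<mu> (F i))"
      unfolding upper_value_def[of \<mu> "\<Union>i. F i"]
    proof (rule SUP_least, clarify)
      fix C :: "'a set" assume [measurable]: "C \<in> sets borel" and C: "C \<subseteq> (\<Union>i. F i)"
      have "(\<lambda>i. \<mu> (C \<inter> F i)) sums \<mu> (\<Union>i. C \<inter> F i)"
        using F(2) by (intro signed_borel_measure_sums[OF m]) (auto simp: disjoint_family_on_def)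
      also have "(\<Union>i. C \<inter> F i) = C" using C by auto
      finally have s: "(\<lambda>n. \<Sum>i<n. \<mu> (C \<inter> F i)) \<longlonglongrightarrow> \<mu> C" by (simp add: sums_def)
      have "ennreal (\<Sum>i<n. \<mu> (C \<inter> F i)) \<le> (\<Sum>i. upper_value \<mu> (F i))" for n
      proof -
        have "ennreal (\<Sum>i<n. \<mu> (C \<inter> F i)) \<le> ennreal (\<Sum>i<n. max 0 (\<mu> (C \<inter> F i)))"
          by (intro ennreal_leI sum_mono) auto
        also have "\<dots> = (\<Sum>i<n. ennreal (\<mu> (C \<inter> F i)))"
          proof -
            have "ennreal (max 0 x) = ennreal x" for x :: real
              by (simp add: max_def ennreal_neg)
            then show ?thesis by (subst sum_ennreal[symmetric]) simp_all
          qed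
        also have "\<dots> \<le> (\<Sum>i<n. upper_value \<mu> (F i))"
          by (intro sum_mono upper_value_upper) auto
        also have "\<dots> \<le> (\<Sum>i. upper_value \<mu> (F i))"
          by (intro sum_le_suminf) auto
        finally show ?thesis .
      qed
      moreover have "(\<lambda>n. ennreal (\<Sum>i<n. \<mu> (C \<inter> F i))) \<longlonglongrightarrow> ennreal (\<mu> C)"
        using s by (rule tendsto_ennrealI)
      ultimately show "ennreal (\<mu> C) \<le> (\<Sum>i. upper_value \<mu> (F i))"
        by (intro LIMSEQ_le_const2) auto
    qed
  qed
qed

lemma sets_upper_variation [simp, measurable_cong]: "sets (upper_variation \<mu>) = sets borel"
  unfolding upper_variation_def using sets.sigma_sets_eq[of borel]
  by (simp add: sets_measure_of_conv)

lemma space_upper_variation [simp]: "space (upper_variation \<mu>) = UNIV"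
  unfolding upper_variation_def by (simp add: space_measure_of_conv)

lemma emeasure_upper_variation:
  assumes m: "signed_borel_measure \<mu>" and "B \<in> sets borel"
  shows "emeasure (upper_variation \<mu>) B = upper_value \<mu> B"
proof (rule emeasure_measure_of[where \<Omega>=UNIV and A="sets borel"])
  show "upper_variation \<mu> = measure_of UNIV (sets borel) (upper_value \<mu>)"
    unfolding upper_variation_def upper_value_def by simp
  show "positive (sets (upper_variation \<mu>)) (upper_value \<mu>)"
    by (simp add: positive_def upper_value_empty[OF m])
  show "countably_additive (sets (upper_variation \<mu>)) (upper_value \<mu>)"
    using countably_additive_upper_value[OF m] by simp
qed (use assms in auto)

lemma emeasure_upper_variation_le:
  assumes m: "signed_borel_measure \<mu>" and "B \<in> sets borel"
    and "\<And>C. C \<in> sets borel \<Longrightarrow> C \<subseteq> B \<Longrightarrow> \<mu> C \<le> x"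
  shows "emeasure (upper_variation \<mu>) B \<le> ennreal x"
  unfolding emeasure_upper_variation[OF assms(1,2)] upper_value_def
  using assms(3) by (auto intro!: SUP_least ennreal_leI)

lemma finite_measure_upper_variation:
  assumes m: "signed_borel_measure \<mu>" and "total_variation \<mu> < \<infinity>"
  shows "finite_measure (upper_variation \<mu>)"
proof (rule finite_measureI)
  obtain T where T: "total_variation \<mu> = ereal T"
    using assms(2) total_variation_nonneg[of \<mu>] by (cases "total_variation \<mu>") auto
  have "\<mu> C \<le> T" if "C \<in> sets borel" for C
    using abs_diff_le_total_variation[OF m that, of "{}"] T signed_borel_measure_empty[OF m] by auto
  then have "emeasure (upper_variation \<mu>) UNIV \<le> ennreal T"
    by (intro emeasure_upper_variation_le[OF m]) auto
  then show "emeasure (upper_variation \<mu>) (space (upper_variation \<mu>)) \<noteq> \<infinity>"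
    by (auto simp: top_unique)
qed

lemma measure_upper_variation_ge:
  assumes m: "signed_borel_measure \<mu>" and "total_variation \<mu> < \<infinity>"
    and "B \<in> sets borel" "C \<in> sets borel" "C \<subseteq> B"
  shows "\<mu> C \<le> measure (upper_variation \<mu>) B"
proof -
  interpret finite_measure "upper_variation \<mu>"
    using finite_measure_upper_variation[OF m assms(2)] .
  have "ennreal (\<mu> C) \<le> ennreal (measure (upper_variation \<mu>) B)"
    using upper_value_upper[OF assms(4,5), of \<mu>] emeasure_upper_variation[OF m assms(3)]
    by (simp add: emeasure_eq_measure)
  then show ?thesis
    by (cases "\<mu> C \<le> 0") (auto intro: order_trans[OF _ measure_nonneg])
qed

text \<open>
  Together with \<open>measure_upper_variation_ge\<close> this says that the upper variation of \<open>B\<close> is the least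
  upper bound of the values \<open>\<mu> C\<close> with \<open>C \<subseteq> B\<close>. The remaining arguments use only this.
\<close>

lemma measure_upper_variation_le:
  assumes m: "signed_borel_measure \<mu>" and "B \<in> sets borel"
    and le: "\<And>C. C \<in> sets borel \<Longrightarrow> C \<subseteq> B \<Longrightarrow> \<mu> C \<le> x"
  shows "measure (upper_variation \<mu>) B \<le> x"
proof -
  have "0 \<le> x" using le[of "{}"] signed_borel_measure_empty[OF m] by simp
  then show ?thesis
    using emeasure_upper_variation_le[OF assms] by (simp add: measure_def enn2real_leI)
qed

text \<open>
  Passing from \<open>C\<close> to \<open>B - C\<close> exchanges \<open>\<mu> C\<close> for \<open>\<mu> B\<close> plus a value of \<open>-\<mu>\<close>; taking suprema compares the
  two variations.
\<close>

lemma Jordan_decomposition: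
  assumes m: "signed_borel_measure \<mu>" and tv: "total_variation \<mu> < \<infinity>" and B: "B \<in> sets borel"
  shows "measure (upper_variation \<mu>) B - measure (upper_variation (\<lambda>B. - \<mu> B)) B = \<mu> B"
proof -
  have le: "measure (upper_variation \<nu>) B \<le> \<nu> B + measure (upper_variation (\<lambda>B. - \<nu> B)) B"
    if m: "signed_borel_measure \<nu>" and tv: "total_variation \<nu> < \<infinity>" for \<nu>
  proof (rule measure_upper_variation_le[OF m B])
    fix C assume C: "C \<in> sets borel" "C \<subseteq> B"
    then have "- \<nu> (B - C) \<le> measure (upper_variation (\<lambda>B. - \<nu> B)) B"
      using tv B by (intro measure_upper_variation_ge[OF signed_borel_measure_uminus[OF m]]) auto
    moreover have "\<nu> (B - C) = \<nu> B - \<nu> C"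
      using signed_borel_measure_Diff[OF m B C(1)] C(2) by (simp add: Int_absorb1)
    ultimately show "\<nu> C \<le> \<nu> B + measure (upper_variation (\<lambda>B. - \<nu> B)) B" by simp
  qed
  from le[OF m tv] le[OF signed_borel_measure_uminus[OF m]] tv show ?thesis by simp
qed

text \<open>
  The two masses are suprema of \<open>\<mu> C\<close> and \<open>- \<mu> D\<close> over independent \<open>C\<close> and \<open>D\<close>, and \<open>\<mu> C - \<mu> D\<close> is at
  most the total variation.
\<close>

lemma variation_masses_le_total_variation:
  assumes m: "signed_borel_measure \<mu>" and T: "total_variation \<mu> \<le> ereal T"
  shows "measure (upper_variation \<mu>) UNIV + measure (upper_variation (\<lambda>B. - \<mu> B)) UNIV \<le> T"
proof -
  have "measure (upper_variation \<mu>) UNIV \<le> T - measure (upper_variation (\<lambda>B. - \<mu> B)) UNIV"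
  proof (rule measure_upper_variation_le[OF m])
    fix C :: "'a set" assume C: "C \<in> sets borel"
    have "measure (upper_variation (\<lambda>B. - \<mu> B)) UNIV \<le> T - \<mu> C"
    proof (rule measure_upper_variation_le[OF signed_borel_measure_uminus[OF m]])
      fix D :: "'a set" assume D: "D \<in> sets borel"
      show "- \<mu> D \<le> T - \<mu> C"
        using order_trans[OF abs_diff_le_total_variation[OF m C D] T] by simp
    qed simp
    then show "\<mu> C \<le> T - measure (upper_variation (\<lambda>B. - \<mu> B)) UNIV" by simp
  qed simp
  then show ?thesis by simp
qed

section \<open>Integrals against signed measures\<close>

lemma set_integrable_bounded:
  fixes \<phi> :: "'a::topological_space \<Rightarrow> real"
  assumes "finite_measure M" "sets M = sets borel" 
    and "set_borel_measurable borel S \<phi>" and "\<And>x. x \<in> S \<Longrightarrow> \<bar>\<phi> x\<bar> \<le> c"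
  shows "set_integrable M S \<phi>"
proof -
  interpret finite_measure M by fact
  have "(\<lambda>x. indicator S x *\<^sub>R \<phi> x) \<in> borel_measurable M"
    using assms(2,3) unfolding set_borel_measurable_def by (simp cong: measurable_cong_sets)
  moreover have "norm (indicator S x *\<^sub>R \<phi> x) \<le> \<bar>c\<bar>" for x
    using assms(4)[of x] by (auto simp: indicator_def)
  ultimately show ?thesis
    unfolding set_integrable_def by (intro integrable_const_bound[of _ "\<bar>c\<bar>"]) auto
qed

lemma abs_set_integral_le:
  fixes \<phi> :: "'a::topological_space \<Rightarrow> real"
  assumes "finite_measure M" "sets M = sets borel" 
    and "set_borel_measurable borel S \<phi>" and c: "\<And>x. x \<in> S \<Longrightarrow> \<bar>\<phi> x\<bar> \<le> c" "0 \<le> c"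
  shows "\<bar>set_lebesgue_integral M S \<phi>\<bar> \<le> c * measure M UNIV"
proof -
  interpret finite_measure M by fact
  have sp: "space M = UNIV" using assms(2) sets_eq_imp_space_eq[of M borel] by simp
  have i: "integrable M (\<lambda>x. indicator S x *\<^sub>R \<phi> x)"
    using set_integrable_bounded[OF assms(1-4)] by (simp add: set_integrable_def)
  have "norm (set_lebesgue_integral M S \<phi>) \<le> (\<integral>x. norm (indicator S x *\<^sub>R \<phi> x) \<partial>M)"
    unfolding set_lebesgue_integral_def by (rule integral_norm_bound)
  also have "\<dots> \<le> (\<integral>x. c \<partial>M)"
    using i c by (intro integral_mono) (auto simp: indicator_def)
  also have "\<dots> = c * measure M UNIV" by (simp add: sp)
  finally show ?thesis by simp
qed

lemma abs_signed_integral_le: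
  assumes m: "signed_borel_measure \<mu>" and T: "total_variation \<mu> \<le> ereal T"
    and "set_borel_measurable borel S \<phi>" and c: "\<And>x. x \<in> S \<Longrightarrow> \<bar>\<phi> x\<bar> \<le> c" "0 \<le> c"
  shows "\<bar>signed_integral S \<mu> \<phi>\<bar> \<le> c * T"
proof -
  have tv: "total_variation \<mu> < \<infinity>" using T by (auto simp: less_top[symmetric] top_ereal_def)
  have "\<bar>set_lebesgue_integral (upper_variation \<mu>) S \<phi>\<bar> \<le> c * measure (upper_variation \<mu>) UNIV"
    using assms tv by (intro abs_set_integral_le finite_measure_upper_variation) auto
  moreover have "\<bar>set_lebesgue_integral (upper_variation (\<lambda>B. - \<mu> B)) S \<phi>\<bar>
      \<le> c * measure (upper_variation (\<lambda>B. - \<mu> B)) UNIV"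
    using assms tv
    by (intro abs_set_integral_le finite_measure_upper_variation signed_borel_measure_uminus) auto
  ultimately have "\<bar>signed_integral S \<mu> \<phi>\<bar> \<le>
      c * (measure (upper_variation \<mu>) UNIV + measure (upper_variation (\<lambda>B. - \<mu> B)) UNIV)"
    unfolding signed_integral_def by (simp add: algebra_simps)
  also have "\<dots> \<le> c * T"
    using variation_masses_le_total_variation[OF m T] c(2) by (rule mult_left_mono)
  finally show ?thesis .
qed

lemma signed_integral_linear_combination:
  assumes m: "signed_borel_measure \<mu>" and tv: "total_variation \<mu> < \<infinity>"
    and "\<And>i. i \<in> I \<Longrightarrow> set_borel_measurable borel S (\<phi> i)"
    and "\<And>i x. i \<in> I \<Longrightarrow> x \<in> S \<Longrightarrow> \<bar>\<phi> i x\<bar> \<le> c i"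
  shows "signed_integral S \<mu> (\<lambda>x. \<Sum>i\<in>I. q i * \<phi> i x) = (\<Sum>i\<in>I. q i * signed_integral S \<mu> (\<phi> i))"
proof -
  have "set_lebesgue_integral M S (\<lambda>x. \<Sum>i\<in>I. q i * \<phi> i x) =
      (\<Sum>i\<in>I. q i * set_lebesgue_integral M S (\<phi> i))"
    if "finite_measure M" "sets M = sets borel" for M
  proof -
    have "integrable M (\<lambda>x. indicator S x *\<^sub>R \<phi> i x)" if "i \<in> I" for i
      using set_integrable_bounded[OF \<open>finite_measure M\<close> \<open>sets M = _\<close> assms(3,4)[OF that]] that
      by (simp add: set_integrable_def)
    then show ?thesis
      unfolding set_lebesgue_integral_def
      by (simp add: sum_distrib_left mult.left_commute[of "indicator S _"])
  qed
  note * = this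
  show ?thesis
    unfolding signed_integral_def
    using *[OF finite_measure_upper_variation[OF m tv]]
      *[OF finite_measure_upper_variation[OF signed_borel_measure_uminus[OF m]]] tv
    by (simp add: sum_subtractf algebra_simps)
qed

text \<open>
  This plays the role of an identity between sums of measures. It serves to compare the Jordan
  decomposition with another way of writing a signed measure as a difference.
\<close>

lemma nn_integral_sum_measures_cong:
  assumes sets: "sets A = sets N" "sets B = sets N" "sets C = sets N" "sets D = sets N"
    and eq: "\<And>S. S \<in> sets N \<Longrightarrow> emeasure A S + emeasure B S = emeasure C S + emeasure D S"
    and u: "u \<in> borel_measurable N"
  shows "(\<integral>\<^sup>+x. u x \<partial>A) + (\<integral>\<^sup>+x. u x \<partial>B) = (\<integral>\<^sup>+x. u x \<partial>C) + (\<integral>\<^sup>+x. u x \<partial>D)"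
  using u
proof (induction rule: borel_measurable_induct)
  case (cong f g)
  have sp: "space A = space N" "space B = space N" "space C = space N" "space D = space N"
    using sets_eq_imp_space_eq[OF sets(1)] sets_eq_imp_space_eq[OF sets(2)]
      sets_eq_imp_space_eq[OF sets(3)] sets_eq_imp_space_eq[OF sets(4)] by blast+
  have "integral\<^sup>N X f = integral\<^sup>N X g" if "space X = space N" for X
    using that cong(3) by (intro nn_integral_cong) auto
  with sp cong(4) show ?case by metis
next
  case (set S)
  then show ?case using eq sets by simp
next
  case (mult u c)
  have "u \<in> borel_measurable X" if "sets X = sets N" for X
    using mult(2) that by (simp cong: measurable_cong_sets)
  then show ?case using mult(4) sets
    by (simp add: nn_integral_cmult distrib_left[symmetric])
next
  case (add u v)
  have "u \<in> borel_measurable X" "v \<in> borel_measurable X" if "sets X = sets N" for X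
    using add.hyps(1,3) that by (simp_all cong: measurable_cong_sets)
  then have split: "(\<integral>\<^sup>+x. v x + u x \<partial>X) = integral\<^sup>N X v + integral\<^sup>N X u"
    if "sets X = sets N" for X
    using that by (intro nn_integral_add) auto
  have "(\<integral>\<^sup>+x. v x + u x \<partial>A) + (\<integral>\<^sup>+x. v x + u x \<partial>B) =
      (integral\<^sup>N A v + integral\<^sup>N B v) + (integral\<^sup>N A u + integral\<^sup>N B u)"
    unfolding split[OF sets(1)] split[OF sets(2)] by (simp only: add_ac)
  also have "\<dots> = (integral\<^sup>N C v + integral\<^sup>N D v) + (integral\<^sup>N C u + integral\<^sup>N D u)"
    using add by simp
  also have "\<dots> = (\<integral>\<^sup>+x. v x + u x \<partial>C) + (\<integral>\<^sup>+x. v x + u x \<partial>D)"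
    unfolding split[OF sets(3)] split[OF sets(4)] by (simp only: add_ac)
  finally show ?case .
next
  case (seq U)
  have U: "U i \<in> borel_measurable X" if "sets X = sets N" for X i
    using seq.hyps(1) that by (simp cong: measurable_cong_sets)
  have mono: "incseq (\<lambda>i. integral\<^sup>N X (U i))" for X
    using seq.hyps(3) by (auto simp: incseq_def le_fun_def intro!: nn_integral_mono)
  have S: "integral\<^sup>N X (SUP i. U i) = (SUP i. integral\<^sup>N X (U i))" if "sets X = sets N" for X
    using nn_integral_monotone_convergence_SUP[OF seq.hyps(3) U[OF that]] by (simp add: SUP_apply[abs_def])
  show ?case
    unfolding SUP_apply[symmetric] S[OF sets(1)] S[OF sets(2)] S[OF sets(3)] S[OF sets(4)]
    using seq.IH mono by (simp add: ennreal_SUP_add[symmetric])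
qed

text \<open>
  A bounded function becomes nonnegative by adding a constant, and all four measures are finite.
\<close>

lemma integral_sum_measures_cong:
  fixes g :: "'a \<Rightarrow> real"
  assumes fin: "finite_measure A" "finite_measure B" "finite_measure C" "finite_measure D"
    and sets: "sets A = sets N" "sets B = sets N" "sets C = sets N" "sets D = sets N"
    and eq: "\<And>S. S \<in> sets N \<Longrightarrow> measure A S + measure B S = measure C S + measure D S"
    and g: "g \<in> borel_measurable N" and K: "\<And>x. \<bar>g x\<bar> \<le> K"
  shows "integral\<^sup>L A g + integral\<^sup>L B g = integral\<^sup>L C g + integral\<^sup>L D g"
proof -
  let ?h = "\<lambda>x. g x + K"
  have pos: "0 \<le> ?h x" for x using K[of x] by simp
  have int: "integrable X g" if "finite_measure X" "sets X = sets N" for X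
  proof -
    interpret finite_measure X by fact
    show ?thesis
      using g K that by (intro integrable_const_bound[of _ K]) (auto cong: measurable_cong_sets)
  qed
  have shift: "integral\<^sup>L X ?h = integral\<^sup>L X g + K * measure X (space N)"
    and nn: "(\<integral>\<^sup>+x. ennreal (?h x) \<partial>X) = ennreal (integral\<^sup>L X ?h)"
    if "finite_measure X" "sets X = sets N" for X
  proof -
    interpret finite_measure X by fact
    show "integral\<^sup>L X ?h = integral\<^sup>L X g + K * measure X (space N)"
      using int[OF that] sets_eq_imp_space_eq[OF that(2)] by simp
    show "(\<integral>\<^sup>+x. ennreal (?h x) \<partial>X) = ennreal (integral\<^sup>L X ?h)"
      using int[OF that] pos by (intro nn_integral_eq_integral) auto
  qed
  have "ennreal (integral\<^sup>L A ?h) + ennreal (integral\<^sup>L B ?h) =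
      ennreal (integral\<^sup>L C ?h) + ennreal (integral\<^sup>L D ?h)"
  proof -
    have "emeasure A S + emeasure B S = emeasure C S + emeasure D S" if "S \<in> sets N" for S
      using eq[OF that] fin
      by (simp add: finite_measure.emeasure_eq_measure flip: ennreal_plus)
    from nn_integral_sum_measures_cong[OF sets this, of "\<lambda>x. ennreal (?h x)"] g
    show ?thesis by (simp only: nn fin sets) simp
  qed
  then have "integral\<^sup>L A ?h + integral\<^sup>L B ?h = integral\<^sup>L C ?h + integral\<^sup>L D ?h"
    using pos by (simp add: integral_nonneg flip: ennreal_plus)
  moreover have "K * measure A (space N) + K * measure B (space N) =
      K * measure C (space N) + K * measure D (space N)"
    using eq[of "space N"] by (simp flip: distrib_left)
  ultimately show ?thesis
    unfolding shift[OF fin(1) sets(1)] shift[OF fin(2) sets(2)]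
      shift[OF fin(3) sets(3)] shift[OF fin(4) sets(4)] by linarith
qed

text \<open>
  A signed measure given by any two finite measures, which need not be its Jordan decomposition.
\<close>

definition difference_measure :: "'a::topological_space measure \<Rightarrow> 'a measure \<Rightarrow> 'a set \<Rightarrow> real" where
  "difference_measure M N B = (if B \<in> sets borel then measure M B - measure N B else 0)"

context
  fixes M N :: "'a::topological_space measure"
  assumes fin: "finite_measure M" "finite_measure N"
    and sets: "sets M = sets borel" "sets N = sets borel"
begin

lemma signed_borel_measure_difference: "signed_borel_measure (difference_measure M N)"
  unfolding signed_borel_measure_def
proof (intro conjI allI impI)
  fix F :: "nat \<Rightarrow> 'a set" assume F: "range F \<subseteq> sets borel" "disjoint_family F"
  have "(\<lambda>i. measure X (F i)) sums measure X (\<Union>i. F i)"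
    if "finite_measure X" "sets X = sets borel" for X
    using that F by (intro finite_measure.finite_measure_UNION) auto
  from sums_diff[OF this[OF fin(1) sets(1)] this[OF fin(2) sets(2)]] F(1)
  show "(\<lambda>n. difference_measure M N (F n)) sums difference_measure M N (\<Union> (range F))"
    unfolding difference_measure_def by (auto simp: image_subset_iff sets.countable_UN)
qed (simp add: difference_measure_def)

lemma total_variation_difference_le:
  "total_variation (difference_measure M N) \<le> ereal (measure M UNIV + measure N UNIV)"
  unfolding total_variation_def
proof (rule SUP_least, clarify)
  fix P :: "'a set set" assume P: "finite P" "P \<subseteq> sets borel" "disjoint P"
  have *: "(\<Sum>B\<in>P. measure X B) \<le> measure X UNIV" if "finite_measure X" "sets X = sets borel" for X
  proof -
    interpret finite_measure X by fact
    have "space X = UNIV" using that(2) sets_eq_imp_space_eq[of X borel] by simp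
    have "(\<Sum>B\<in>P. measure X B) = measure X (\<Union>B\<in>P. B)"
      using P that by (intro finite_measure_finite_Union[symmetric])
        (auto simp: disjoint_family_on_def disjoint_def)
    also have "\<dots> \<le> measure X UNIV"
      using bounded_measure[of "\<Union>P"] \<open>space X = UNIV\<close> by simp
    finally show ?thesis .
  qed
  have "(\<Sum>B\<in>P. \<bar>difference_measure M N B\<bar>) \<le> (\<Sum>B\<in>P. measure M B + measure N B)"
    using P by (intro sum_mono) (auto simp: difference_measure_def abs_le_iff measure_nonneg add_increasing)
  also have "\<dots> \<le> measure M UNIV + measure N UNIV"
    using *[OF fin(1) sets(1)] *[OF fin(2) sets(2)] by (simp add: sum.distrib)
  finally show "ereal (\<Sum>B\<in>P. \<bar>difference_measure M N B\<bar>) \<le> ereal (measure M UNIV + measure N UNIV)"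
    by simp
qed

text \<open>
  Rearranged without subtraction, \<open>U - L = M - N\<close> becomes an equality of sums of measures, where \<open>U\<close>
  and \<open>L\<close> are the two variations of the difference.
\<close>

lemma signed_integral_difference:
  assumes \<phi>: "set_borel_measurable borel S \<phi>" and c: "\<And>x. x \<in> S \<Longrightarrow> \<bar>\<phi> x\<bar> \<le> c"
  shows "signed_integral S (difference_measure M N) \<phi> =
    set_lebesgue_integral M S \<phi> - set_lebesgue_integral N S \<phi>"
proof -
  let ?\<mu> = "difference_measure M N"
  let ?U = "upper_variation ?\<mu>" and ?L = "upper_variation (\<lambda>B. - ?\<mu> B)"
  let ?g = "\<lambda>x. indicator S x *\<^sub>R \<phi> x"
  note m = signed_borel_measure_difference
  have tv: "total_variation ?\<mu> < \<infinity>"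
    using total_variation_difference_le by (auto intro: le_less_trans)
  have "integral\<^sup>L ?U ?g + integral\<^sup>L N ?g = integral\<^sup>L ?L ?g + integral\<^sup>L M ?g"
  proof (rule integral_sum_measures_cong[where N=borel and K="\<bar>c\<bar>"])
    show "finite_measure ?U" "finite_measure ?L"
      using m tv by (auto intro: finite_measure_upper_variation signed_borel_measure_uminus)
    show "measure ?U B + measure N B = measure ?L B + measure M B" if "B \<in> sets borel" for B
      using Jordan_decomposition[OF m tv that] that by (simp add: difference_measure_def)
    show "\<bar>?g x\<bar> \<le> \<bar>c\<bar>" for x using c[of x] by (auto simp: indicator_def)
  qed (use fin sets \<phi> in \<open>auto simp: set_borel_measurable_def\<close>)
  then show ?thesis
    unfolding signed_integral_def set_lebesgue_integral_def by simp
qed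

end

section \<open>Measures with finite support\<close>

lemma radon_measures_finite_support:
  assumes \<mu>: "\<mu> \<in> radon_measures V" and V: "finite V" and B: "B \<in> sets borel"
  shows "\<mu> B = (\<Sum>v\<in>V \<inter> B. \<mu> {v})"
proof -
  have m: "signed_borel_measure \<mu>" using \<mu> by (simp add: radon_measures_def)
  have fin: "\<mu> F = (\<Sum>v\<in>F. \<mu> {v})" if "finite F" for F
    using that
  proof induction
    case (insert x F)
    have "F \<in> sets borel" using insert(1) by (simp add: borel_closed finite_imp_closed)
    then show ?case
      using signed_borel_measure_Un[OF m, of "{x}" F] insert by simp
  qed (simp add: signed_borel_measure_empty[OF m])
  have VB: "V \<inter> B \<in> sets borel" using V by (simp add: borel_closed finite_imp_closed)
  have "\<mu> (B - V \<inter> B) = 0"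
  proof -
    have "(B - V \<inter> B) \<inter> V = {}" "B - V \<inter> B \<in> sets borel" using B VB by auto
    then show ?thesis using \<mu> unfolding radon_measures_def by blast
  qed
  moreover have "\<mu> (B - V \<inter> B) = \<mu> B - \<mu> (V \<inter> B)"
    using signed_borel_measure_Diff[OF m B VB] by (simp add: Int_absorb1)
  ultimately show ?thesis using fin[of "V \<inter> B"] V by simp
qed

text \<open>
  The upper bound splits every value over the atoms; each atom lies in at most one set of a disjoint
  family. The family of the singletons attains it.
\<close>

lemma total_variation_atomic:
  fixes V :: "'a::euclidean_space set"
  assumes V: "finite V" and \<mu>: "\<And>B. B \<in> sets borel \<Longrightarrow> \<mu> B = (\<Sum>v\<in>V \<inter> B. c v)"
  shows "total_variation \<mu> = ereal (\<Sum>v\<in>V. \<bar>c v\<bar>)"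
proof (rule antisym)
  show "total_variation \<mu> \<le> ereal (\<Sum>v\<in>V. \<bar>c v\<bar>)"
    unfolding total_variation_def
  proof (rule SUP_least, clarify)
    fix P :: "'a set set" assume P: "finite P" "P \<subseteq> sets borel" "disjoint P"
    have "(\<Sum>B\<in>P. \<bar>\<mu> B\<bar>) \<le> (\<Sum>B\<in>P. \<Sum>v\<in>V \<inter> B. \<bar>c v\<bar>)"
      using P(2) by (intro sum_mono) (auto simp: \<mu> subset_iff)
    also have "\<dots> = (\<Sum>v\<in>(\<Union>B\<in>P. V \<inter> B). \<bar>c v\<bar>)"
      using P V by (intro sum.UNION_disjoint[symmetric]) (auto simp: disjoint_def)
    also have "\<dots> \<le> (\<Sum>v\<in>V. \<bar>c v\<bar>)"
      using V by (intro sum_mono2) auto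
    finally show "ereal (\<Sum>B\<in>P. \<bar>\<mu> B\<bar>) \<le> ereal (\<Sum>v\<in>V. \<bar>c v\<bar>)" by simp
  qed
  have "\<mu> {v} = c v" if "v \<in> V" for v using that by (simp add: \<mu>)
  then have "(\<Sum>v\<in>V. \<bar>c v\<bar>) = (\<Sum>B\<in>(\<lambda>v. {v}) ` V. \<bar>\<mu> B\<bar>)"
    by (subst sum.reindex) (auto simp: inj_on_def intro!: sum.cong)
  also have "ereal \<dots> \<le> total_variation \<mu>"
    using V by (intro sum_abs_le_total_variation) (auto simp: disjoint_def)
  finally show "ereal (\<Sum>v\<in>V. \<bar>c v\<bar>) \<le> total_variation \<mu>" .
qed

lemma set_integral_finite_support:
  fixes V :: "'a::euclidean_space set" and \<phi> :: "'a \<Rightarrow> real"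
  assumes M: "finite_measure M" "sets M = sets borel" and null: "emeasure M (- V) = 0"
    and V: "finite V" "V \<subseteq> S" and \<phi>: "set_borel_measurable borel S \<phi>"
  shows "set_lebesgue_integral M S \<phi> = (\<Sum>v\<in>V. \<phi> v * measure M {v})"
proof -
  interpret finite_measure M by fact
  have "V \<in> sets borel" using V by (simp add: borel_closed finite_imp_closed)
  then have "- V \<in> null_sets M" using null M(2) by (auto simp: null_sets_def)
  then have AE: "AE x in M. indicator S x *\<^sub>R \<phi> x = (\<Sum>v\<in>V. \<phi> v * indicator {v} x)"
  proof (rule AE_I')
    show "{x \<in> space M. indicator S x *\<^sub>R \<phi> x \<noteq> (\<Sum>v\<in>V. \<phi> v * indicator {v} x)} \<subseteq> - V"
      using V by (auto simp: indicator_def if_distrib[of "\<lambda>z. _ * z"] cong: if_cong)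
  qed
  have "set_lebesgue_integral M S \<phi> = (\<integral>x. (\<Sum>v\<in>V. \<phi> v * indicator {v} x) \<partial>M)"
    unfolding set_lebesgue_integral_def
    using \<phi> M(2) by (intro integral_cong_AE[OF _ _ AE])
      (auto simp: set_borel_measurable_def cong: measurable_cong_sets)
  also have "\<dots> = (\<Sum>v\<in>V. \<phi> v * measure M {v})"
    using M(2) by (subst Bochner_Integration.integral_sum)
      (auto intro!: integrable_mult_right simp: emeasure_eq_measure)
  finally show ?thesis .
qed

text \<open>
  Both variations vanish off \<open>V\<close>, and on singletons their difference is \<open>\<mu>\<close> by the Jordan decomposition.
\<close>

lemma signed_integral_finite_support:
  fixes V :: "'a::euclidean_space set"
  assumes \<mu>: "\<mu> \<in> radon_measures V" and V: "finite V" "V \<subseteq> S"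
    and \<phi>: "set_borel_measurable borel S \<phi>"
  shows "signed_integral S \<mu> \<phi> = (\<Sum>v\<in>V. \<mu> {v} * \<phi> v)"
proof -
  have m: "signed_borel_measure \<mu>" and tv: "total_variation \<mu> < \<infinity>"
    using \<mu> by (auto simp: radon_measures_def)
  note m' = signed_borel_measure_uminus[OF m]
  have Vc: "- V \<in> sets borel" using V by (simp add: borel_closed finite_imp_closed)
  have z: "\<mu> C = 0" if "C \<in> sets borel" "C \<subseteq> - V" for C
    using \<mu> that by (auto simp: radon_measures_def)
  have "emeasure (upper_variation \<mu>) (- V) = 0" "emeasure (upper_variation (\<lambda>B. - \<mu> B)) (- V) = 0"
    using emeasure_upper_variation_le[OF m Vc, of 0] emeasure_upper_variation_le[OF m' Vc, of 0] z
    by auto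
  then show ?thesis
    unfolding signed_integral_def
    using set_integral_finite_support[OF finite_measure_upper_variation[OF m tv] _ _ V \<phi>]
      set_integral_finite_support[OF finite_measure_upper_variation[OF m'] _ _ V \<phi>] tv
      Jordan_decomposition[OF m tv]
    by (simp add: sum_subtractf[symmetric] right_diff_distrib[symmetric] mult.commute)
qed

definition atomic_measure :: "'a::euclidean_space set \<Rightarrow> ('a \<Rightarrow> real) \<Rightarrow> 'a set \<Rightarrow> real" where
  "atomic_measure V c B = (if B \<in> sets borel then \<Sum>v\<in>V \<inter> B. c v else 0)"

lemma atomic_measure_singleton: "v \<in> V \<Longrightarrow> atomic_measure V c {v} = c v"
  by (simp add: atomic_measure_def)

lemma atomic_measure_in_radon_measures:
  fixes V :: "'a::euclidean_space set"
  assumes V: "finite V"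
  shows "atomic_measure V c \<in> radon_measures V"
proof -
  have eq: "(\<Sum>v\<in>V \<inter> B. c v) = (\<Sum>v\<in>V. c v * indicator B v)" for B
    using V by (auto simp: indicator_def sum.inter_restrict if_distrib cong: if_cong)
  have "signed_borel_measure (atomic_measure V c)"
    unfolding signed_borel_measure_def
  proof (intro conjI allI impI)
    fix F :: "nat \<Rightarrow> 'a set" assume F: "range F \<subseteq> sets borel" "disjoint_family F"
    have "(\<lambda>i. indicator (F i) v :: real) sums indicator (\<Union>i. F i) v" for v
      using disjoint_family_onD[OF F(2)] by (intro indicator_sums) auto
    then have "(\<lambda>i. \<Sum>v\<in>V. c v * indicator (F i) v) sums (\<Sum>v\<in>V. c v * indicator (\<Union>i. F i) v)"
      by (intro sums_sum sums_mult)
    then show "(\<lambda>n. atomic_measure V c (F n)) sums atomic_measure V c (\<Union> (range F))"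
      using F(1) unfolding atomic_measure_def eq by (auto simp: image_subset_iff sets.countable_UN)
  qed (simp add: atomic_measure_def)
  moreover have "total_variation (atomic_measure V c) < \<infinity>"
    using total_variation_atomic[OF V, of "atomic_measure V c" c] by (simp add: atomic_measure_def)
  moreover have "atomic_measure V c B = 0" if "B \<inter> V = {}" for B
    using that by (simp add: atomic_measure_def Int_commute)
  ultimately show ?thesis by (simp add: radon_measures_def)
qed

section \<open>A space-filling curve\<close>

text \<open>
  The digits are those of the doubling map: \<open>y n\<close> is the remainder after \<open>n\<close> digits, scaled by \<open>2 ^ n\<close>.
\<close>

lemma binary_expansion:
  assumes "x \<in> {0..1::real}"
  obtains b :: "nat \<Rightarrow> bool" where "(\<lambda>n. of_bool (b n) / 2 ^ Suc n) sums x"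
proof -
  define y where "y n = rec_nat x (\<lambda>_ y. 2 * y - of_bool (y \<ge> 1/2)) n" for n
  have y0: "y 0 = x" and ySuc: "y (Suc n) = 2 * y n - of_bool (y n \<ge> 1/2)" for n
    by (simp_all add: y_def)
  have y: "0 \<le> y n \<and> y n \<le> 1" for n
    by (induction n) (use assms in \<open>auto simp: y0 ySuc\<close>)
  have part: "(\<Sum>i<n. of_bool (y i \<ge> 1/2) / 2 ^ Suc i) = x - y n / 2 ^ n" for n
    by (induction n) (auto simp: y0 ySuc field_simps)
  have "(\<lambda>n. y n / 2 ^ n) \<longlonglongrightarrow> 0"
  proof (rule tendsto_sandwich[where f="\<lambda>_. 0" and h="\<lambda>n. (1/2) ^ n"])
    show "(\<lambda>n. (1/2::real) ^ n) \<longlonglongrightarrow> 0" by (intro LIMSEQ_power_zero) simp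
  qed (use y in \<open>auto simp: power_one_over divide_simps\<close>)
  from tendsto_diff[OF tendsto_const[of x] this]
  have "(\<lambda>n. of_bool (y n \<ge> 1/2) / 2 ^ Suc n) sums x"
    unfolding sums_def part by simp
  then show ?thesis by (rule that)
qed

text \<open>
  A continuous function of period 2 that is 0 on \<open>[0, 1/3]\<close> and 1 on \<open>[2/3, 1]\<close>. Applied to \<open>3 ^ k * t\<close>,
  it reads the \<open>k\<close>-th ternary digit, 0 or 2, of a point \<open>t\<close> of the Cantor set as a bit.
\<close>

definition schoenberg_digit :: "real \<Rightarrow> real" where
  "schoenberg_digit t = max 0 (min 1 (1/2 - cos (pi * t)))"

lemma schoenberg_digit_bounds: "0 \<le> schoenberg_digit t" "schoenberg_digit t \<le> 1"
  by (auto simp: schoenberg_digit_def)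

lemma continuous_schoenberg_digit: "continuous_on UNIV schoenberg_digit"
  unfolding schoenberg_digit_def by (intro continuous_intros)

lemma schoenberg_digit_periodic: "schoenberg_digit (t + 2 * real n) = schoenberg_digit t"
proof -
  have "cos (pi * (t + 2 * real n)) = cos (pi * t + real n * (2 * pi))"
    by (simp add: algebra_simps)
  also have "\<dots> = cos (pi * t)"
  proof (induction n)
    case (Suc n)
    have "cos (pi * t + real (Suc n) * (2 * pi)) = cos (pi * t + real n * (2 * pi) + 2 * pi)"
      by (simp add: algebra_simps)
    then show ?case using Suc by simp
  qed simp
  finally show ?thesis by (simp add: schoenberg_digit_def)
qed

lemma schoenberg_digit_0: "0 \<le> t \<Longrightarrow> t \<le> 1/3 \<Longrightarrow> schoenberg_digit t = 0"
  using cos_monotone_0_pi_le[of "pi * t" "pi / 3"]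
  by (simp add: schoenberg_digit_def cos_60)

lemma schoenberg_digit_1: "2/3 \<le> t \<Longrightarrow> t \<le> 1 \<Longrightarrow> schoenberg_digit t = 1"
  using cos_monotone_0_pi_le[of "2 * pi / 3" "pi * t"] cos_120
  by (simp add: schoenberg_digit_def field_simps)

definition ternary_point :: "(nat \<Rightarrow> bool) \<Rightarrow> real" where
  "ternary_point b = (\<Sum>j. 2 * of_bool (b j) / 3 ^ Suc j)"

lemma ternary_point_sums: "(\<lambda>j. 2 * of_bool (b j) / 3 ^ Suc j) sums ternary_point b"
  and ternary_point_bounds: "0 \<le> ternary_point b" "ternary_point b \<le> 1"
proof -
  have g: "(\<lambda>j. 2 * (1/3) * (1/3::real) ^ j) sums (2 * (1/3) * (1 / (1 - 1/3)))"
    by (intro sums_mult geometric_sums) simp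
  have le: "2 * of_bool (b j) / 3 ^ Suc j \<le> 2 * (1/3) * (1/3::real) ^ j" for j
    by (simp add: power_one_over divide_simps)
  have s: "summable (\<lambda>j. 2 * of_bool (b j) / (3::real) ^ Suc j)"
    by (rule summable_comparison_test'[OF sums_summable[OF g], of 0]) (use le in auto)
  then show "(\<lambda>j. 2 * of_bool (b j) / 3 ^ Suc j) sums ternary_point b"
    unfolding ternary_point_def by (rule summable_sums)
  show "0 \<le> ternary_point b"
    unfolding ternary_point_def by (rule suminf_nonneg[OF s]) simp
  show "ternary_point b \<le> 1"
    unfolding ternary_point_def
    using suminf_le[OF le s sums_summable[OF g]] sums_unique[OF g] by simp
qed

lemma ternary_point_Suc: "3 * ternary_point b = 2 * of_bool (b 0) + ternary_point (\<lambda>j. b (Suc j))"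
proof -
  have "(\<lambda>j. 3 * (2 * of_bool (b (Suc j)) / 3 ^ Suc (Suc j))) sums (3 * (ternary_point b - 2 * of_bool (b 0) / 3))"
  proof (rule sums_mult)
    show "(\<lambda>j. 2 * of_bool (b (Suc j)) / 3 ^ Suc (Suc j)) sums (ternary_point b - 2 * of_bool (b 0) / 3)"
      using ternary_point_sums[of b] sums_Suc_iff[of "\<lambda>j. 2 * of_bool (b j) / (3::real) ^ Suc j"]
      by (simp del: of_bool_eq_1_iff)
  qed
  also have "(\<lambda>j. 3 * (2 * of_bool (b (Suc j)) / 3 ^ Suc (Suc j))) = (\<lambda>j. 2 * of_bool (b (Suc j)) / (3::real) ^ Suc j)"
    by auto
  finally show ?thesis
    using sums_unique2[OF ternary_point_sums[of "\<lambda>j. b (Suc j)"]] by (simp add: algebra_simps)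
qed

text \<open>
  Multiplication by 3 shifts the digits and adds 0 or 2. After further multiplications by 3 the added
  number is still an even integer, which the period absorbs.
\<close>

lemma schoenberg_digit_ternary_point: "schoenberg_digit (3 ^ k * ternary_point b) = of_bool (b k)"
proof (induction k arbitrary: b)
  case 0
  show ?case
    using ternary_point_Suc[of b] ternary_point_bounds[of "\<lambda>j. b (Suc j)"]
    by (cases "b 0") (auto intro!: schoenberg_digit_0 schoenberg_digit_1)
next
  case (Suc k)
  have "3 ^ Suc k * ternary_point b = 3 ^ k * (3 * ternary_point b)" by simp
  also have "\<dots> = 3 ^ k * ternary_point (\<lambda>j. b (Suc j)) + 2 * real (3 ^ k * of_bool (b 0))"
    unfolding ternary_point_Suc by (simp add: algebra_simps)
  finally show ?case by (simp only: schoenberg_digit_periodic Suc)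
qed

text \<open>
  Schoenberg's construction in dimension \<open>D\<close>: the binary digits of the \<open>i\<close>-th coordinate are the
  ternary digits of the parameter at the positions congruent to \<open>h i\<close> modulo \<open>D\<close>. The curve is
  defined on the whole line, as are the test functions of weak convergence on the line.
\<close>

lemma space_filling_curve_exists:
  obtains \<gamma> :: "real \<Rightarrow> real^'d::finite"
  where "continuous_on UNIV \<gamma>" "range \<gamma> \<subseteq> unit_cube" "unit_cube \<subseteq> \<gamma> ` {0..1}"
proof -
  let ?D = "CARD('d)"
  obtain h :: "'d \<Rightarrow> nat" where h: "bij_betw h UNIV {0..<?D}"
    using ex_bij_betw_finite_nat[of "UNIV :: 'd set"] by auto
  have hlt: "h i < ?D" for i using h by (auto simp: bij_betw_def)
  \<comment> \<open>the \<open>n\<close>-th term of the binary expansion of coordinate \<open>i\<close> of the curve\<close>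
  define p where "p i n t = schoenberg_digit (3 ^ (n * ?D + h i) * t) / 2 ^ Suc n" for i n t
  have half: "(\<lambda>n. 1 / (2::real) ^ Suc n) sums 1"
    using power_half_series by (simp add: power_one_over)
  have p: "0 \<le> p i n t" "p i n t \<le> 1 / 2 ^ Suc n" for i n t
    using schoenberg_digit_bounds by (auto simp: p_def divide_simps)
  have ps: "summable (\<lambda>n. p i n t)" for i t
    by (rule summable_comparison_test'[OF sums_summable[OF half], of 0]) (use p in auto)
  define \<gamma> where "\<gamma> t = (\<chi> i. \<Sum>n. p i n t)" for t
  have "continuous_on UNIV (\<lambda>t. \<Sum>n. p i n t)" for i
  proof (rule uniform_limit_theorem)
    show "uniform_limit UNIV (\<lambda>n t. \<Sum>k<n. p i k t) (\<lambda>t. \<Sum>k. p i k t) sequentially"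
      by (rule Weierstrass_m_test[OF _ sums_summable[OF half]]) (use p in auto)
    have "continuous_on UNIV (p i n)" for n
      unfolding p_def
      by (intro continuous_intros continuous_on_compose2[OF continuous_schoenberg_digit]) auto
    then show "\<forall>\<^sub>F n in sequentially. continuous_on UNIV (\<lambda>t. \<Sum>k<n. p i k t)"
      by (intro always_eventually allI continuous_on_sum) auto
  qed simp
  then have "continuous_on UNIV \<gamma>"
    unfolding \<gamma>_def by (intro continuous_on_vec_lambda)
  moreover have "range \<gamma> \<subseteq> unit_cube"
  proof -
    have "0 \<le> (\<Sum>n. p i n t)" "(\<Sum>n. p i n t) \<le> 1" for i t
      using suminf_nonneg[OF ps] suminf_le[OF _ ps sums_summable[OF half]] p sums_unique[OF half] by auto
    then show ?thesis by (auto simp: unit_cube_def mem_box_cart \<gamma>_def)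
  qed
  moreover have "unit_cube \<subseteq> \<gamma> ` {0..1}"
  proof
    fix x :: "real^'d" assume "x \<in> unit_cube"
    then have "x $ i \<in> {0..1}" for i by (simp add: unit_cube_def mem_box_cart)
    then have "\<exists>b. (\<lambda>n. of_bool (b n) / 2 ^ Suc n) sums (x $ i)" for i
      using binary_expansion by metis
    then obtain b where b: "(\<lambda>n. of_bool (b i n) / 2 ^ Suc n) sums (x $ i)" for i
      by metis
    define t where "t = ternary_point (\<lambda>k. b (inv_into UNIV h (k mod ?D)) (k div ?D))"
    have "p i n t = of_bool (b i n) / 2 ^ Suc n" for i n
      using hlt[of i] h by (simp add: p_def t_def schoenberg_digit_ternary_point bij_betw_def)
    then have "\<gamma> t = x"
      using sums_unique[OF b] by (simp add: \<gamma>_def vec_eq_iff)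
    then show "x \<in> \<gamma> ` {0..1}"
      using ternary_point_bounds by (force simp: t_def)
  qed
  ultimately show ?thesis by (rule that)
qed

section \<open>Weak-* compactness of bounded families of atomic measures\<close>

lemma set_borel_measurable_continuous_unit_cube:
  fixes \<phi> :: "real^'d::finite \<Rightarrow> real"
  shows "continuous_on unit_cube \<phi> \<Longrightarrow> set_borel_measurable borel unit_cube \<phi>"
  unfolding set_borel_measurable_def unit_cube_def
  by (rule borel_measurable_continuous_on_indicator) simp_all

lemma bounded_continuous_unit_cube:
  fixes \<phi> :: "real^'d::finite \<Rightarrow> real"
  assumes "continuous_on unit_cube \<phi>"
  obtains c where "0 \<le> c" "\<And>x. x \<in> unit_cube \<Longrightarrow> \<bar>\<phi> x\<bar> \<le> c"
proof -
  have "bounded (\<phi> ` unit_cube)"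
    using assms unfolding unit_cube_def by (intro compact_imp_bounded compact_continuous_image) auto
  then obtain c where "\<And>x. x \<in> unit_cube \<Longrightarrow> \<bar>\<phi> x\<bar> \<le> c"
    by (auto simp: bounded_iff)
  then show ?thesis using that[of "\<bar>c\<bar>"] by force
qed

text \<open>
  Every atom is lifted to a parameter in \<open>[0, 1]\<close> of the space-filling curve \<open>\<gamma>\<close>. After normalization,
  the lifted measures are tight probability distributions on the line, so a subsequence converges
  weakly. The limit, rescaled by the limit of the masses, is pushed forward along \<open>\<gamma>\<close>. A continuous
  \<open>\<phi>\<close> on the cube becomes the bounded continuous test function \<open>\<phi> \<circ> \<gamma>\<close>.
\<close>

lemma weak_limit_of_atoms:
  fixes V :: "nat \<Rightarrow> (real^'d::finite) set" and w :: "nat \<Rightarrow> real^'d \<Rightarrow> real"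
  assumes V: "\<And>k. finite (V k)" "\<And>k. V k \<subseteq> unit_cube"
    and w: "\<And>k v. v \<in> V k \<Longrightarrow> 0 \<le> w k v" "\<And>k. (\<Sum>v\<in>V k. w k v) \<le> R"
  obtains r and M :: "(real^'d) measure"
  where "strict_mono r" "finite_measure M" "sets M = sets borel" "emeasure M (- unit_cube) = 0"
    "\<And>\<phi>. continuous_on unit_cube \<phi> \<Longrightarrow>
      (\<lambda>k. \<Sum>v\<in>V (r k). w (r k) v * \<phi> v) \<longlonglongrightarrow> set_lebesgue_integral M unit_cube \<phi>"
proof -
  obtain \<gamma> :: "real \<Rightarrow> real^'d"
    where \<gamma>: "continuous_on UNIV \<gamma>" "range \<gamma> \<subseteq> unit_cube" "unit_cube \<subseteq> \<gamma> ` {0..1}"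
    by (rule space_filling_curve_exists)
  have [measurable]: "\<gamma> \<in> borel_measurable borel"
    using \<gamma>(1) by (rule borel_measurable_continuous_onI)
  \<comment> \<open>a choice of parameters \<open>s v\<close>; it is measurable on every \<open>V k\<close> with the discrete sigma-algebra\<close>
  have "\<forall>v\<in>unit_cube. \<exists>t\<in>{0..1}. \<gamma> t = v" using \<gamma>(3) by (auto simp: subset_iff image_iff)
  then obtain s where s: "\<And>v. v \<in> unit_cube \<Longrightarrow> s v \<in> {0..1}" "\<And>v. v \<in> unit_cube \<Longrightarrow> \<gamma> (s v) = v"
    by metis
  define m where "m k = (\<Sum>v\<in>V k. w k v)" for k
  have m: "m k \<in> {0..R}" for k using w by (auto simp: m_def intro: sum_nonneg)
  obtain m' r1 where m': "strict_mono (r1 :: nat \<Rightarrow> nat)" "m' \<in> {0..R}" "(m \<circ> r1) \<longlonglongrightarrow> m'"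
    using compact_Icc[of 0 R] m unfolding compact_def by metis
  \<comment> \<open>without mass there is nothing to normalize, and any distribution on \<open>[0, 1]\<close> serves\<close>
  define P where "P k = (if m k = 0 then return borel (0::real)
    else distr (point_measure (V k) (\<lambda>v. ennreal (w k v / m k))) borel s)" for k
  have pm: "prob_space (point_measure (V k) (\<lambda>v. ennreal (w k v / m k)))" if "m k \<noteq> 0" for k
  proof (rule prob_spaceI)
    have "(\<Sum>v\<in>V k. ennreal (w k v / m k)) = ennreal (\<Sum>v\<in>V k. w k v / m k)"
      using w m[of k] by (intro sum_ennreal) auto
    also have "(\<Sum>v\<in>V k. w k v / m k) = 1"
      using that by (simp add: sum_divide_distrib[symmetric] m_def)
    finally show "emeasure (point_measure (V k) (\<lambda>v. ennreal (w k v / m k)))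
        (space (point_measure (V k) (\<lambda>v. ennreal (w k v / m k)))) = 1"
      using V by (simp add: emeasure_point_measure_finite space_point_measure)
  qed
  have sm: "s \<in> measurable (point_measure (V k) p) borel" for k p
    by (simp add: point_measure_def)
  have dist: "real_distribution (P k)" for k
  proof (cases "m k = 0")
    case True
    then show ?thesis
      by (auto simp: P_def real_distribution_def real_distribution_axioms_def prob_space_return)
  next
    case False
    then show ?thesis
      using prob_space.real_distribution_distr[OF pm sm] by (simp add: P_def)
  qed
  have meas: "measure (P k) {-1<..1} = 1" for k
  proof (cases "m k = 0")
    case False
    interpret prob_space "point_measure (V k) (\<lambda>v. ennreal (w k v / m k))" by (rule pm[OF False])
    have "s -` {-1<..1} \<inter> V k = V k"
      using s(1) V(2)[of k] by force
    then show ?thesis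
      using False sm prob_space by (simp add: P_def measure_distr space_point_measure)
  qed (simp add: P_def measure_return)
  have "tight P"
    unfolding tight_def
  proof (intro conjI allI impI)
    fix e :: real assume "0 < e"
    then show "\<exists>a b. a < b \<and> (\<forall>n. 1 - e < measure (P n) {a<..b})"
      using meas by (intro exI[of _ "-1"] exI[of _ 1]) simp
  qed (rule dist)
  then obtain r2 Q where r2: "strict_mono (r2 :: nat \<Rightarrow> nat)" and Q: "real_distribution Q"
      and conv: "weak_conv_m (P \<circ> r1 \<circ> r2) Q"
    using tight_imp_convergent_subsubsequence[OF _ m'(1)] by metis
  interpret Q: real_distribution Q by (rule Q)
  define M where "M = density (distr Q borel \<gamma>) (\<lambda>_. ennreal m')"
  have "finite_measure M"
    unfolding M_def using m'(2)
    by (intro finite_measureI) (simp add: emeasure_density_const emeasure_distr ennreal_mult_eq_top_iff)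
  moreover have "sets M = sets borel" by (simp add: M_def)
  moreover have "emeasure M (- unit_cube) = 0"
  proof -
    have "\<gamma> -` (- unit_cube) = {}" using \<gamma>(2) by auto
    then show ?thesis
      by (simp add: M_def emeasure_density_const emeasure_distr unit_cube_def)
  qed
  moreover have "(\<lambda>k. \<Sum>v\<in>V (r1 (r2 k)). w (r1 (r2 k)) v * \<phi> v) \<longlonglongrightarrow> set_lebesgue_integral M unit_cube \<phi>"
    if \<phi>: "continuous_on unit_cube \<phi>" for \<phi>
  proof -
    have c: "continuous_on UNIV (\<lambda>t. \<phi> (\<gamma> t))"
      using continuous_on_compose2[OF \<phi> \<gamma>(1,2)] .
    have c': "isCont (\<lambda>t. \<phi> (\<gamma> t)) t" for t
      using c by (simp add: continuous_on_eq_continuous_at)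
    obtain B where B: "\<And>x. x \<in> unit_cube \<Longrightarrow> \<bar>\<phi> x\<bar> \<le> B"
      using bounded_continuous_unit_cube[OF \<phi>] by metis
    have "norm (\<phi> (\<gamma> t)) \<le> B" for t using B \<gamma>(2) by (auto simp: subset_iff)
    then have lim: "(\<lambda>n. integral\<^sup>L ((P \<circ> r1 \<circ> r2) n) (\<lambda>t. \<phi> (\<gamma> t))) \<longlonglongrightarrow> integral\<^sup>L Q (\<lambda>t. \<phi> (\<gamma> t))"
      using dist by (intro weak_conv_imp_integral_bdd_continuous_conv[OF _ Q conv] c') auto
    have pk: "m k * integral\<^sup>L (P k) (\<lambda>t. \<phi> (\<gamma> t)) = (\<Sum>v\<in>V k. w k v * \<phi> v)" for k
    proof (cases "m k = 0")
      case True
      then have "\<forall>v\<in>V k. w k v = 0"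
        using V w by (simp add: m_def sum_nonneg_eq_0_iff)
      then show ?thesis using True by simp
    next
      case False
      have "(\<lambda>t. \<phi> (\<gamma> t)) \<in> borel_measurable borel"
        using c by (rule borel_measurable_continuous_onI)
      then have "integral\<^sup>L (P k) (\<lambda>t. \<phi> (\<gamma> t)) = (\<Sum>v\<in>V k. w k v / m k * \<phi> (\<gamma> (s v)))"
        using False V w m[of k]
        by (simp add: P_def integral_distr[OF sm] lebesgue_integral_point_measure_finite)
      also have "\<dots> = (\<Sum>v\<in>V k. w k v * \<phi> v) / m k"
        using s(2) V(2)[of k] by (auto simp: sum_divide_distrib subset_iff intro!: sum.cong)
      finally show ?thesis using False by simp
    qed
    have g: "(\<lambda>x. indicator unit_cube x *\<^sub>R \<phi> x) \<in> borel_measurable borel"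
      using set_borel_measurable_continuous_unit_cube[OF \<phi>] by (simp add: set_borel_measurable_def)
    have "set_lebesgue_integral M unit_cube \<phi> =
        (\<integral>x. m' *\<^sub>R (indicator unit_cube x *\<^sub>R \<phi> x) \<partial>distr Q borel \<gamma>)"
      unfolding M_def set_lebesgue_integral_def using g m'(2) by (intro integral_density) auto
    also have "\<dots> = (\<integral>t. m' *\<^sub>R (indicator unit_cube (\<gamma> t) *\<^sub>R \<phi> (\<gamma> t)) \<partial>Q)"
      using g by (intro integral_distr) auto
    also have "\<dots> = m' * integral\<^sup>L Q (\<lambda>t. \<phi> (\<gamma> t))"
      using \<gamma>(2) by (simp add: subset_iff)
    finally show ?thesis
      using tendsto_mult[OF LIMSEQ_subseq_LIMSEQ[OF m'(3) r2] lim] by (simp add: pk o_def)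
  qed
  ultimately show ?thesis
    using that[of "r1 \<circ> r2" M] strict_mono_o[OF m'(1) r2] by simp
qed

lemma difference_measure_in_radon_measures:
  fixes M N :: "'a::euclidean_space measure"
  assumes fin: "finite_measure M" "finite_measure N"
    and sets: "sets M = sets borel" "sets N = sets borel"
    and null: "emeasure M (- S) = 0" "emeasure N (- S) = 0" and S: "S \<in> sets borel"
  shows "difference_measure M N \<in> radon_measures S"
proof -
  have "measure X B = 0"
    if "finite_measure X" "sets X = sets borel" "emeasure X (- S) = 0" "B \<in> sets borel" "B \<inter> S = {}"
    for X :: "'a measure" and B
  proof -
    have "emeasure X B \<le> emeasure X (- S)"
      using that S by (intro emeasure_mono) auto
    then show ?thesis using that(3) by (simp add: measure_def)
  qed
  then have "difference_measure M N B = 0" if "B \<in> sets borel" "B \<inter> S = {}" for B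
    using fin sets null that by (simp add: difference_measure_def)
  moreover have "total_variation (difference_measure M N) < \<infinity>"
    using total_variation_difference_le[OF fin sets] by (auto intro: le_less_trans)
  ultimately show ?thesis
    using signed_borel_measure_difference[OF fin sets] by (simp add: radon_measures_def)
qed

text \<open>
  The positive and negative parts converge separately. Testing with the constant 1 shows that their
  masses converge too, to those of the two limits, and the sum of these masses bounds the total
  variation of the limit from above.
\<close>

lemma finite_support_weak_star_compact:
  fixes V :: "nat \<Rightarrow> (real^'d::finite) set"
  assumes V: "\<And>k. finite (V k)" "\<And>k. V k \<subseteq> unit_cube"
    and \<mu>: "\<And>k. \<mu> k \<in> radon_measures (V k)" "\<And>k. total_variation (\<mu> k) \<le> ereal R"
  obtains r \<nu> t T where "strict_mono r" "\<nu> \<in> radon_measures unit_cube"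
    "\<And>\<phi>. continuous_on unit_cube \<phi> \<Longrightarrow>
      (\<lambda>k. signed_integral unit_cube (\<mu> (r k)) \<phi>) \<longlonglongrightarrow> signed_integral unit_cube \<nu> \<phi>"
    "\<And>k. total_variation (\<mu> (r k)) = ereal (t k)" "t \<longlonglongrightarrow> T" "total_variation \<nu> \<le> ereal T"
proof -
  define p where "p k v = max 0 (\<mu> k {v})" for k v
  define n where "n k v = max 0 (- \<mu> k {v})" for k v
  have tv: "total_variation (\<mu> k) = ereal (\<Sum>v\<in>V k. p k v + n k v)" for k
  proof -
    have "total_variation (\<mu> k) = ereal (\<Sum>v\<in>V k. \<bar>\<mu> k {v}\<bar>)"
      using V \<mu> by (intro total_variation_atomic radon_measures_finite_support) auto
    also have "(\<Sum>v\<in>V k. \<bar>\<mu> k {v}\<bar>) = (\<Sum>v\<in>V k. p k v + n k v)"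
      by (intro sum.cong) (auto simp: p_def n_def)
    finally show ?thesis .
  qed
  have pos: "0 \<le> p k v" "0 \<le> n k v" for k v by (auto simp: p_def n_def)
  have le: "(\<Sum>v\<in>V k. p k v) + (\<Sum>v\<in>V k. n k v) \<le> R" for k
    using \<mu>(2)[of k] by (simp add: tv sum.distrib)
  have lep: "(\<Sum>v\<in>V k. p k v) \<le> R" and len: "(\<Sum>v\<in>V k. n k v) \<le> R" for k
    using le[of k] sum_nonneg[of "V k" "p k"] sum_nonneg[of "V k" "n k"] pos by auto
  obtain r1 M where r1: "strict_mono r1" and M: "finite_measure M" "sets M = sets borel" "emeasure M (- unit_cube) = 0"
    and Mlim: "\<And>\<phi>. continuous_on unit_cube \<phi> \<Longrightarrow>
      (\<lambda>k. \<Sum>v\<in>V (r1 k). p (r1 k) v * \<phi> v) \<longlonglongrightarrow> set_lebesgue_integral M unit_cube \<phi>"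
    by (rule weak_limit_of_atoms[of V p R, OF V pos(1) lep]) auto
  obtain r2 N where r2: "strict_mono r2" and N: "finite_measure N" "sets N = sets borel" "emeasure N (- unit_cube) = 0"
    and Nlim: "\<And>\<phi>. continuous_on unit_cube \<phi> \<Longrightarrow>
      (\<lambda>k. \<Sum>v\<in>V (r1 (r2 k)). n (r1 (r2 k)) v * \<phi> v) \<longlonglongrightarrow> set_lebesgue_integral N unit_cube \<phi>"
    by (rule weak_limit_of_atoms[of "\<lambda>k. V (r1 k)" "\<lambda>k. n (r1 k)" R, OF V pos(2) len]) auto
  let ?r = "r1 \<circ> r2" and ?\<nu> = "difference_measure M N"
  have Mlim': "(\<lambda>k. \<Sum>v\<in>V (?r k). p (?r k) v * \<phi> v) \<longlonglongrightarrow> set_lebesgue_integral M unit_cube \<phi>"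
    if "continuous_on unit_cube \<phi>" for \<phi>
    using LIMSEQ_subseq_LIMSEQ[OF Mlim[OF that] r2] by (simp add: o_def)
  show ?thesis
  proof (rule that)
    show "strict_mono ?r" using r1 r2 by (rule strict_mono_o)
    show "?\<nu> \<in> radon_measures unit_cube"
      using M N by (intro difference_measure_in_radon_measures) (auto simp: unit_cube_def)
    show "total_variation (\<mu> (?r k)) = ereal (\<Sum>v\<in>V (?r k). p (?r k) v + n (?r k) v)" for k
      by (rule tv)
    have one: "set_lebesgue_integral X unit_cube (\<lambda>_. 1) = measure X UNIV"
      if X: "finite_measure X" "sets X = sets borel" "emeasure X (- unit_cube) = 0"
      for X :: "(real^'d) measure"
    proof -
      interpret finite_measure X by fact
      have sp: "space X = UNIV" using sets_eq_imp_space_eq[OF X(2)] by simp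
      have uc: "unit_cube \<in> sets X" by (simp add: X(2) unit_cube_def)
      have "measure X UNIV = measure X unit_cube + measure X (- unit_cube)"
        using finite_measure_Union[of unit_cube "- unit_cube"] uc sp sets.compl_sets[OF uc]
        by (simp add: Compl_eq_Diff_UNIV)
      then show ?thesis
        using X(3) by (simp add: set_lebesgue_integral_def measure_def sp)
    qed
    show "(\<lambda>k. \<Sum>v\<in>V (?r k). p (?r k) v + n (?r k) v) \<longlonglongrightarrow> measure M UNIV + measure N UNIV"
      using tendsto_add[OF Mlim'[of "\<lambda>_. 1"] Nlim[of "\<lambda>_. 1"]] one[OF M] one[OF N]
      by (simp add: sum.distrib)
    show "total_variation ?\<nu> \<le> ereal (measure M UNIV + measure N UNIV)"
      using M N by (intro total_variation_difference_le)
    fix \<phi> :: "real^'d \<Rightarrow> real" assume \<phi>: "continuous_on unit_cube \<phi>"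
    note meas = set_borel_measurable_continuous_unit_cube[OF \<phi>]
    obtain c where c: "\<And>x. x \<in> unit_cube \<Longrightarrow> \<bar>\<phi> x\<bar> \<le> c"
      using bounded_continuous_unit_cube[OF \<phi>] by metis
    have "signed_integral unit_cube (\<mu> k) \<phi> =
        (\<Sum>v\<in>V k. p k v * \<phi> v) - (\<Sum>v\<in>V k. n k v * \<phi> v)" for k
      unfolding signed_integral_finite_support[OF \<mu>(1) V meas] sum_subtractf[symmetric]
      by (intro sum.cong) (auto simp: p_def n_def max_def)
    moreover have "signed_integral unit_cube ?\<nu> \<phi> =
        set_lebesgue_integral M unit_cube \<phi> - set_lebesgue_integral N unit_cube \<phi>"
      using M N c by (intro signed_integral_difference meas) auto
    ultimately show "(\<lambda>k. signed_integral unit_cube (\<mu> (?r k)) \<phi>) \<longlonglongrightarrow> signed_integral unit_cube ?\<nu> \<phi>"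
      using tendsto_diff[OF Mlim'[OF \<phi>] Nlim[OF \<phi>]] by simp
  qed
qed

section \<open>Strong duality in finite dimension\<close>

lemma pointwise_convergent_subsequence:
  fixes c :: "nat \<Rightarrow> 'a \<Rightarrow> real"
  assumes "finite V" and "\<And>k v. v \<in> V \<Longrightarrow> \<bar>c k v\<bar> \<le> R"
  shows "\<exists>r l. strict_mono (r :: nat \<Rightarrow> nat) \<and> (\<forall>v\<in>V. (\<lambda>k. c (r k) v) \<longlonglongrightarrow> l v)"
  using assms
proof (induction V)
  case empty
  show ?case by (intro exI[of _ id]) (simp add: strict_mono_def)
next
  case (insert x V)
  then obtain r l where r: "strict_mono (r :: nat \<Rightarrow> nat)" "\<forall>v\<in>V. (\<lambda>k. c (r k) v) \<longlonglongrightarrow> l v"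
    by auto
  have "c (r k) x \<in> {-R..R}" for k
    using insert.prems[of x "r k"] by (auto simp: abs_le_iff)
  then obtain y r' where r': "strict_mono (r' :: nat \<Rightarrow> nat)" "((\<lambda>k. c (r k) x) \<circ> r') \<longlonglongrightarrow> y"
    using compact_Icc[of "-R" R] unfolding compact_def by (metis (no_types, lifting))
  have "(\<lambda>k. c ((r \<circ> r') k) v) \<longlonglongrightarrow> (l(x := y)) v" if "v \<in> insert x V" for v
    using that r' LIMSEQ_subseq_LIMSEQ[OF _ r'(1), of "\<lambda>k. c (r k) v" "l v"] r(2) insert.hyps
    by (auto simp: o_def)
  then show ?case using strict_mono_o[OF r(1) r'(1)] by blast
qed

lemma ereal_convexD:
  assumes "ereal_convex f" "f x \<le> ereal r" "f y \<le> ereal s" "0 \<le> u" "u \<le> 1"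
  shows "f ((1 - u) *\<^sub>R x + u *\<^sub>R y) \<le> ereal ((1 - u) * r + u * s)"
proof -
  have "f ((1 - u) *\<^sub>R x + u *\<^sub>R y) \<le> ereal (1 - u) * f x + ereal u * f y"
    using assms(1,4,5) unfolding ereal_convex_def by auto
  also have "\<dots> \<le> ereal (1 - u) * ereal r + ereal u * ereal s"
    using assms by (intro add_mono ereal_mult_left_mono) auto
  finally show ?thesis by simp
qed

text \<open>
  Here \<open>\<Sum>v\<in>V. \<bar>c v\<bar>\<close> is the norm of the weight vector \<open>c\<close>, and \<open>p\<close> is a lower bound of the primal
  problem. That bound says that the epigraph \<open>E\<close> of \<open>f\<close> does not meet the convex set \<open>H\<close> of the points
  \<open>(A c, p - t)\<close> with \<open>t\<close> larger than the norm of \<open>c\<close>. The slope of a separating hyperplane is the dual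
  variable.
\<close>

lemma finite_strong_duality:
  fixes f :: "'b::euclidean_space \<Rightarrow> ereal" and s :: "'a \<Rightarrow> 'b"
  assumes minf: "\<And>y. f y \<noteq> -\<infinity>" and conv: "ereal_convex f" and V: "finite V"
    and p: "\<And>c. ereal p \<le> ereal (\<Sum>v\<in>V. \<bar>c v\<bar>) + f (\<Sum>v\<in>V. c v *\<^sub>R s v)"
    and slater: "(\<Sum>v\<in>V. c0 v *\<^sub>R s v) \<in> interior (effective_domain f)"
  obtains q where "\<And>v. v \<in> V \<Longrightarrow> \<bar>q \<bullet> s v\<bar> \<le> 1" "fenchel_conjugate f q \<le> ereal (- p)"
proof -
  define N where "N c = (\<Sum>v\<in>V. \<bar>c v\<bar>)" for c :: "'a \<Rightarrow> real"
  define A where "A c = (\<Sum>v\<in>V. c v *\<^sub>R s v)" for c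
  define E where "E = {(y, t). f y \<le> ereal t}"
  define H where "H = {(A c, p - t) | c t. N c < t}"
  have "convex E"
    unfolding convex_alt E_def using ereal_convexD[OF conv] by auto
  have "convex H"
    unfolding convex_alt H_def
  proof (clarify)
    fix c d :: "'a \<Rightarrow> real" and t t' u :: real
    assume u: "0 \<le> u" "u \<le> 1" and t: "N c < t" "N d < t'"
    let ?c = "\<lambda>v. (1 - u) * c v + u * d v" and ?t = "(1 - u) * t + u * t'"
    have "A ?c = (1 - u) *\<^sub>R A c + u *\<^sub>R A d"
      by (simp add: A_def scaleR_add_left sum.distrib scaleR_sum_right)
    moreover have "N ?c < ?t"
    proof -
      have "N ?c \<le> (\<Sum>v\<in>V. (1 - u) * \<bar>c v\<bar> + u * \<bar>d v\<bar>)"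
        unfolding N_def using u by (intro sum_mono order_trans[OF abs_triangle_ineq]) (simp add: abs_mult)
      also have "\<dots> = (1 - u) * N c + u * N d"
        by (simp add: N_def sum.distrib sum_distrib_left)
      also have "\<dots> < ?t"
        using convex_bound_lt[of "N c - t" 0 "N d - t'" "1 - u" u] u t by (simp add: algebra_simps)
      finally show ?thesis .
    qed
    ultimately show "\<exists>c' t''. (1 - u) *\<^sub>R (A c, p - t) + u *\<^sub>R (A d, p - t') = (A c', p - t'') \<and> N c' < t''"
      by (intro exI[of _ ?c] exI[of _ ?t]) (simp add: algebra_simps)
  qed
  have "E \<inter> H = {}"
  proof -
    have "\<not> f (A c) \<le> ereal (p - t)" if "N c < t" for c t
      using p[of c] that by (cases "f (A c)") (auto simp: N_def A_def)
    then show ?thesis by (auto simp: E_def H_def)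
  qed
  moreover have "f (A c0) < \<infinity>"
    using slater interior_subset by (auto simp: A_def effective_domain_def)
  then obtain r0 where r0: "f (A c0) = ereal r0"
    using minf[of "A c0"] by (cases "f (A c0)") auto
  have "(A c0, r0) \<in> E" using r0 by (simp add: E_def)
  then have "E \<noteq> {}" by auto
  moreover have "(A c0, p - (N c0 + 1)) \<in> H" 
    unfolding H_def by (intro CollectI exI[of _ c0] exI[of _ "N c0 + 1"]) simp
  then have "H \<noteq> {}" by auto
  ultimately obtain z b where z: "z \<noteq> 0" "\<And>x. x \<in> H \<Longrightarrow> z \<bullet> x \<le> b" "\<And>x. x \<in> E \<Longrightarrow> b \<le> z \<bullet> x"
    using separating_hyperplane_sets[OF \<open>convex H\<close> \<open>convex E\<close>] by (metis Int_commute)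
  obtain w l where zwl: "z = (w, l)" by (cases z)
  have onE: "b \<le> w \<bullet> y + l * t" if "f y \<le> ereal t" for y t
    using z(3)[of "(y, t)"] that by (simp add: E_def zwl)
  have onH: "w \<bullet> A c + l * (p - t) \<le> b" if "N c < t" for c t
    using z(2)[of "(A c, p - t)"] that by (auto simp: H_def zwl)
  have "0 \<le> l"
  proof (rule ccontr)
    assume "\<not> 0 \<le> l"
    \<comment> \<open>a height at which the hyperplane inequality on the epigraph would fail for negative \<open>l\<close>\<close>
    let ?t = "max r0 ((b - w \<bullet> A c0 - 1) / l)"
    have "l * ?t \<le> l * ((b - w \<bullet> A c0 - 1) / l)"
      using \<open>\<not> 0 \<le> l\<close> by (intro mult_left_mono_neg) auto
    also have "\<dots> = b - w \<bullet> A c0 - 1" using \<open>\<not> 0 \<le> l\<close> by simp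
    finally have "l * ?t \<le> b - w \<bullet> A c0 - 1" .
    moreover have "b \<le> w \<bullet> A c0 + l * ?t" by (rule onE) (simp add: r0)
    ultimately show False by simp
  qed
  moreover have "l \<noteq> 0"
  proof
    \<comment> \<open>a vertical hyperplane would support the domain of \<open>f\<close> at the interior point \<open>A c0\<close>\<close>
    assume "l = 0"
    then have "w \<noteq> 0" using z(1) zwl \<open>l = 0\<close> by (auto simp: zero_prod_def)
    obtain e where e: "0 < e" "ball (A c0) e \<subseteq> effective_domain f"
      using slater by (auto simp: A_def mem_interior)
    \<comment> \<open>a step from \<open>A c0\<close> against \<open>w\<close> stays in the domain\<close>
    define y where "y = A c0 - (e / 2 / norm w) *\<^sub>R w"
    have "y \<in> effective_domain f"
      using e \<open>w \<noteq> 0\<close> by (intro subsetD[OF e(2)]) (simp add: y_def dist_norm)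
    then obtain t where "f y \<le> ereal t"
      using minf[of y] by (cases "f y") (auto simp: effective_domain_def)
    from onE[OF this] have "b \<le> w \<bullet> y" using \<open>l = 0\<close> by simp
    also have "\<dots> = w \<bullet> A c0 - e / 2 * norm w"
      using \<open>w \<noteq> 0\<close> by (simp add: y_def inner_diff_right dot_square_norm power2_eq_square)
    also have "\<dots> < w \<bullet> A c0" using e \<open>w \<noteq> 0\<close> by simp
    also have "\<dots> \<le> b" using onH[of c0 "N c0 + 1"] \<open>l = 0\<close> by simp
    finally show False by simp
  qed
  ultimately have l: "0 < l" by simp
  have onH': "w \<bullet> A c + l * (p - N c) \<le> b" for c
  proof (rule field_le_epsilon)
    fix e :: real assume "0 < e"
    then show "w \<bullet> A c + l * (p - N c) \<le> b + e"
      using onH[of c "N c + e / l"] l by (simp add: algebra_simps)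
  qed
  have lp: "l * p \<le> b" using onH'[of "\<lambda>_. 0"] by (simp add: A_def N_def)
  define q where "q = - (1 / l) *\<^sub>R w"
  show ?thesis
  proof (rule that)
    show "fenchel_conjugate f q \<le> ereal (- p)"
      unfolding fenchel_conjugate_def
    proof (rule SUP_least)
      fix y
      show "ereal (q \<bullet> y) - f y \<le> ereal (- p)"
      proof (cases "f y")
        case (real r)
        then have "l * p \<le> w \<bullet> y + l * r" using onE[of y r] lp by simp
        then have "l * (q \<bullet> y - r) \<le> l * (- p)" using l by (simp add: q_def algebra_simps)
        then have "q \<bullet> y - r \<le> - p" using l by (rule mult_left_le_imp_le)
        then show ?thesis using real by simp
      qed (use minf in auto)
    qed
    fix v assume v: "v \<in> V"
    have A1: "\<tau> * (w \<bullet> s v) + l * (p - \<bar>\<tau>\<bar>) \<le> b" for \<tau>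
      using onH'[of "\<lambda>u. if u = v then \<tau> else 0"] v V
      by (simp add: A_def N_def if_distrib[of abs] if_distrib[of "\<lambda>x. x *\<^sub>R _"] cong: if_cong)
    have "\<bar>w \<bullet> s v\<bar> \<le> l"
    proof (rule ccontr)
      assume "\<not> \<bar>w \<bullet> s v\<bar> \<le> l"
      \<comment> \<open>the weight of the single atom at \<open>v\<close> for which the inequality on \<open>H\<close> fails\<close>
      define K where "K = (b - l * p + 1) / (\<bar>w \<bullet> s v\<bar> - l)"
      have K: "0 < K" "K * (\<bar>w \<bullet> s v\<bar> - l) = b - l * p + 1"
        using \<open>\<not> \<bar>w \<bullet> s v\<bar> \<le> l\<close> lp by (simp_all add: K_def)
      have "K * \<bar>w \<bullet> s v\<bar> + l * (p - K) \<le> b"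
        using A1[of K] A1[of "- K"] K(1) by (auto simp: abs_if)
      then show False using K(2) by (simp add: algebra_simps)
    qed
    then show "\<bar>q \<bullet> s v\<bar> \<le> 1" using l by (simp add: q_def abs_mult)
  qed
qed

section \<open>The primal and dual problems\<close>

lemma radon_measures_mono: "V \<subseteq> W \<Longrightarrow> radon_measures V \<subseteq> radon_measures W"
  unfolding radon_measures_def by blast

lemma total_variation_real:
  assumes "\<mu> \<in> radon_measures V"
  obtains T where "total_variation \<mu> = ereal T" "0 \<le> T"
  using assms total_variation_nonneg[of \<mu>]
  by (cases "total_variation \<mu>") (auto simp: radon_measures_def)

lemma dual_feasible_iff:
  "q \<in> dual_feasible a V \<longleftrightarrow> (\<forall>x\<in>V. \<bar>adjoint_measurement a q x\<bar> \<le> 1)"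
  by (simp add: dual_feasible_def sup_norm_on_def SUP_le_iff one_ereal_def)

definition sample :: "('m \<Rightarrow> 'a \<Rightarrow> real) \<Rightarrow> 'a \<Rightarrow> real^'m" where
  "sample a x = (\<chi> m. a m x)"

lemma adjoint_measurement_eq_inner: "adjoint_measurement a q x = q \<bullet> sample a x"
  by (simp add: adjoint_measurement_def sample_def inner_vec_def)

lemma fenchel_conjugate_ge:
  "f y = ereal r \<Longrightarrow> ereal (q \<bullet> y - r) \<le> fenchel_conjugate f q"
  unfolding fenchel_conjugate_def by (rule SUP_upper2[of y]) auto

text \<open>
  A convex function is continuous inside its domain, hence bounded by some \<open>K\<close> on a ball around \<open>y0\<close>.
  In the supremum that defines the conjugate, take the point of that ball farthest in the direction
  of \<open>q\<close>.
\<close>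

lemma interior_domain_imp_conjugate_coercive:
  fixes f :: "'b::euclidean_space \<Rightarrow> ereal"
  assumes minf: "\<And>y. f y \<noteq> -\<infinity>" and conv: "ereal_convex f"
    and y0: "y0 \<in> interior (effective_domain f)"
  obtains r K where "0 < r" "\<And>q. ereal (q \<bullet> y0 + r * norm q - K) \<le> fenchel_conjugate f q"
proof -
  obtain e where e: "0 < e" "ball y0 e \<subseteq> effective_domain f"
    using y0 by (auto simp: mem_interior)
  have fin: "f y = ereal (real_of_ereal (f y))" if "y \<in> ball y0 e" for y
    using e(2) that minf[of y] by (cases "f y") (auto simp: effective_domain_def subset_iff)
  have "convex_on (ball y0 e) (\<lambda>y. real_of_ereal (f y))"
  proof (rule convex_onI)
    fix t :: real and x y assume t: "0 < t" "t < 1" and xy: "x \<in> ball y0 e" "y \<in> ball y0 e"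
    let ?z = "(1 - t) *\<^sub>R x + t *\<^sub>R y"
    have z: "?z \<in> ball y0 e"
      using convex_ball[of y0 e] xy t by (auto simp: convex_alt)
    show "real_of_ereal (f ?z) \<le> (1 - t) * real_of_ereal (f x) + t * real_of_ereal (f y)"
      using ereal_convexD[OF conv, of x "real_of_ereal (f x)" y "real_of_ereal (f y)" t]
        fin[OF xy(1)] fin[OF xy(2)] fin[OF z] t by (metis ereal_less_eq(3) less_eq_real_def order_refl)
  qed simp
  then have "continuous_on (ball y0 e) (\<lambda>y. real_of_ereal (f y))"
    by (intro convex_on_continuous) auto
  then have "continuous_on (cball y0 (e / 2)) (\<lambda>y. real_of_ereal (f y))"
    by (rule continuous_on_subset) (use e in auto)
  then have "bounded ((\<lambda>y. real_of_ereal (f y)) ` cball y0 (e / 2))"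
    by (intro compact_imp_bounded compact_continuous_image) auto
  then obtain K where "\<forall>z\<in>(\<lambda>y. real_of_ereal (f y)) ` cball y0 (e / 2). norm z \<le> K"
    unfolding bounded_iff by blast
  then have K: "\<bar>real_of_ereal (f y)\<bar> \<le> K" if "y \<in> cball y0 (e / 2)" for y
    using that by (metis image_eqI real_norm_def)
  show ?thesis
  proof (rule that)
    show "0 < e / 2" using e by simp
    fix q
    \<comment> \<open>for \<open>q = 0\<close> this is \<open>y0\<close>, since division by zero gives zero\<close>
    define y where "y = y0 + (e / 2 / norm q) *\<^sub>R q"
    have y: "y \<in> cball y0 (e / 2)" using e by (simp add: y_def dist_norm)
    then have "y \<in> ball y0 e" using e(1) by (simp add: dist_commute)
    from fenchel_conjugate_ge[of f, OF fin[OF this], of q]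
    have "ereal (q \<bullet> y - real_of_ereal (f y)) \<le> fenchel_conjugate f q" .
    moreover have "q \<bullet> y = q \<bullet> y0 + e / 2 * norm q"
      by (simp add: y_def inner_add_right dot_square_norm power2_eq_square)
    then have "q \<bullet> y0 + e / 2 * norm q - K \<le> q \<bullet> y - real_of_ereal (f y)"
      using K[OF y] by linarith
    ultimately show "ereal (q \<bullet> y0 + e / 2 * norm q - K) \<le> fenchel_conjugate f q"
      by (meson ereal_less_eq(3) order_trans)
  qed
qed

locale measurement_problem =
  fixes f :: "real^'m::finite \<Rightarrow> ereal" and a :: "'m \<Rightarrow> real^'d::finite \<Rightarrow> real"
  assumes continuous_a: "\<And>m. continuous_on unit_cube (a m)"
    and minf: "\<And>y. f y \<noteq> -\<infinity>"
    and convex_f: "ereal_convex f"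
    and lsc_f: "lower_semicontinuous f"
    and coercive: "coercive_objective f a"
begin

lemma continuous_adjoint_measurement: "continuous_on unit_cube (adjoint_measurement a q)"
  unfolding adjoint_measurement_def[abs_def] by (intro continuous_intros continuous_a)

lemma measurement_finite_support:
  assumes "\<mu> \<in> radon_measures V" "finite V" "V \<subseteq> unit_cube"
  shows "measurement a \<mu> = (\<Sum>v\<in>V. \<mu> {v} *\<^sub>R sample a v)"
  using signed_integral_finite_support[OF assms
      set_borel_measurable_continuous_unit_cube[OF continuous_a]]
  by (simp add: measurement_def sample_def vec_eq_iff)

lemma total_variation_finite_support:
  assumes "\<mu> \<in> radon_measures V" "finite V"
  shows "total_variation \<mu> = ereal (\<Sum>v\<in>V. \<bar>\<mu> {v}\<bar>)"
  using assms by (intro total_variation_atomic radon_measures_finite_support)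

lemma objective_finite_support:
  assumes "\<mu> \<in> radon_measures V" "finite V" "V \<subseteq> unit_cube"
  shows "objective f a \<mu> = ereal (\<Sum>v\<in>V. \<bar>\<mu> {v}\<bar>) + f (\<Sum>v\<in>V. \<mu> {v} *\<^sub>R sample a v)"
  using assms
  by (simp add: objective_def measurement_finite_support total_variation_finite_support)

lemma sublevel_total_variation_bound:
  obtains R where "\<And>\<mu>. \<mu> \<in> radon_measures unit_cube \<Longrightarrow> objective f a \<mu> < ereal C \<Longrightarrow>
    total_variation \<mu> \<le> ereal R"
proof -
  obtain R where "\<forall>\<mu>\<in>radon_measures unit_cube.
      ereal R \<le> total_variation \<mu> \<longrightarrow> ereal C \<le> objective f a \<mu>"
    using coercive unfolding coercive_objective_def by metis
  then show ?thesis using that[of R] by (meson linorder_le_cases not_less)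
qed

text \<open>
  The pairing of \<open>q\<close> with the measurement is the integral of \<open>A*q\<close>, which is bounded by 1 on the cube.
\<close>

lemma inner_measurement_ge:
  assumes \<mu>: "\<mu> \<in> radon_measures unit_cube" and q: "q \<in> dual_feasible a unit_cube"
    and T: "total_variation \<mu> = ereal T"
  shows "- T \<le> q \<bullet> measurement a \<mu>"
proof -
  have m: "signed_borel_measure \<mu>" and tv: "total_variation \<mu> < \<infinity>"
    using \<mu> by (auto simp: radon_measures_def)
  have "\<exists>c. \<forall>x\<in>unit_cube. \<bar>a m x\<bar> \<le> c" for m
    by (rule bounded_continuous_unit_cube[OF continuous_a[of m]]) blast
  then have "\<exists>c. \<forall>m. \<forall>x\<in>unit_cube. \<bar>a m x\<bar> \<le> c m" by (intro choice allI)
  then obtain c where c: "\<And>m x. x \<in> unit_cube \<Longrightarrow> \<bar>a m x\<bar> \<le> c m" by blast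
  have "q \<bullet> measurement a \<mu> = (\<Sum>m\<in>UNIV. q $ m * signed_integral unit_cube \<mu> (a m))"
    by (simp add: measurement_def inner_vec_def)
  also have "\<dots> = signed_integral unit_cube \<mu> (\<lambda>x. \<Sum>m\<in>UNIV. q $ m * a m x)"
    using c by (intro signed_integral_linear_combination[symmetric, OF m tv]
      set_borel_measurable_continuous_unit_cube continuous_a) auto
  also have "(\<lambda>x. \<Sum>m\<in>UNIV. q $ m * a m x) = adjoint_measurement a q"
    by (simp add: adjoint_measurement_def fun_eq_iff)
  finally have "\<bar>q \<bullet> measurement a \<mu>\<bar> \<le> 1 * T"
    using q T by (simp only:) (intro abs_signed_integral_le[OF m]
      set_borel_measurable_continuous_unit_cube continuous_adjoint_measurement;
      simp add: dual_feasible_iff)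
  then show ?thesis by simp
qed

text \<open>
  Feasibility on \<open>V\<close> bounds \<open>A*q\<close> at the atoms only, so the bound on the whole cube does not apply.
\<close>

lemma inner_measurement_ge_finite:
  assumes \<mu>: "\<mu> \<in> radon_measures V" and V: "finite V" "V \<subseteq> unit_cube" and q: "q \<in> dual_feasible a V"
    and T: "total_variation \<mu> = ereal T"
  shows "- T \<le> q \<bullet> measurement a \<mu>"
proof -
  have "\<bar>q \<bullet> measurement a \<mu>\<bar> \<le> (\<Sum>v\<in>V. \<bar>\<mu> {v} * (q \<bullet> sample a v)\<bar>)"
    unfolding measurement_finite_support[OF \<mu> V] by (simp add: inner_sum_right)
  also have "\<dots> \<le> (\<Sum>v\<in>V. \<bar>\<mu> {v}\<bar>)"
    using q by (intro sum_mono)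
      (simp add: dual_feasible_iff adjoint_measurement_eq_inner abs_mult mult_left_le)
  also have "\<dots> = T" using T total_variation_finite_support[OF \<mu> V(1)] by simp
  finally show ?thesis by simp
qed

lemma weak_duality:
  assumes "total_variation \<mu> = ereal T" "- T \<le> q \<bullet> measurement a \<mu>"
  shows "- fenchel_conjugate f q \<le> objective f a \<mu>"
proof (cases "f (measurement a \<mu>)")
  case (real r)
  have "ereal (- T - r) \<le> ereal (q \<bullet> measurement a \<mu> - r)" using assms(2) by simp
  also have "\<dots> \<le> fenchel_conjugate f q" by (rule fenchel_conjugate_ge[of f, OF real])
  finally have "- fenchel_conjugate f q \<le> - ereal (- T - r)"
    by (simp only: ereal_minus_le_minus)
  then show ?thesis by (simp add: objective_def assms(1) real add.commute)
qed (use minf assms in \<open>auto simp: objective_def\<close>)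

lemma weak_duality_unit_cube:
  assumes "q \<in> dual_feasible a unit_cube"
  shows "- fenchel_conjugate f q \<le> primal_value f a unit_cube"
  unfolding primal_value_def
proof (rule INF_greatest)
  fix \<mu> :: "(real^'d) set \<Rightarrow> real" assume \<mu>: "\<mu> \<in> radon_measures unit_cube"
  then obtain T where "total_variation \<mu> = ereal T" by (rule total_variation_real)
  then show "- fenchel_conjugate f q \<le> objective f a \<mu>"
    using weak_duality inner_measurement_ge[OF \<mu> assms] by blast
qed

lemma weak_duality_finite:
  assumes "finite V" "V \<subseteq> unit_cube" "q \<in> dual_feasible a V"
  shows "- fenchel_conjugate f q \<le> primal_value f a V"
  unfolding primal_value_def
proof (rule INF_greatest)
  fix \<mu> :: "(real^'d) set \<Rightarrow> real" assume \<mu>: "\<mu> \<in> radon_measures V"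
  then obtain T where "total_variation \<mu> = ereal T" by (rule total_variation_real)
  then show "- fenchel_conjugate f q \<le> objective f a \<mu>"
    using weak_duality inner_measurement_ge_finite[OF \<mu> assms] by blast
qed

text \<open>
  Along a minimizing sequence the weights of the finitely many atoms are bounded by coercivity. A
  pointwise limit of the weights is a minimizer by lower semicontinuity.
\<close>

lemma finite_primal_solution_exists:
  assumes V: "finite V" "V \<subseteq> unit_cube"
  shows "\<exists>\<mu>. primal_solution f a V \<mu>"
proof (cases "primal_value f a V = \<infinity>")
  case True
  have "primal_value f a V \<le> objective f a (atomic_measure V c)" for c
    unfolding primal_value_def by (intro INF_lower atomic_measure_in_radon_measures V)
  then show ?thesis
    using True atomic_measure_in_radon_measures[OF V(1)] by (auto simp: primal_solution_def)
next
  case False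
  then obtain C where C: "primal_value f a V < ereal C"
    by (metis less_PInf_Ex_of_nat order_less_le top_ereal_def top_greatest)
  have "objective f a ` radon_measures V \<noteq> {}"
    using atomic_measure_in_radon_measures[OF V(1)] by blast
  from Inf_as_limit[OF this] obtain u where u: "\<And>n::nat. u n \<in> objective f a ` radon_measures V"
      and ulim: "u \<longlonglongrightarrow> primal_value f a V"
    unfolding primal_value_def by blast
  have "\<exists>\<mu>. \<forall>n. \<mu> n \<in> radon_measures V \<and> u n = objective f a (\<mu> n)"
    using u by (intro choice) blast
  then obtain \<mu> where \<mu>: "\<And>n. \<mu> n \<in> radon_measures V" and "u = (\<lambda>n. objective f a (\<mu> n))"
    by blast
  with ulim have lim: "(\<lambda>n. objective f a (\<mu> n)) \<longlonglongrightarrow> primal_value f a V" by simp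
  obtain R where R: "\<And>\<mu>. \<mu> \<in> radon_measures unit_cube \<Longrightarrow> objective f a \<mu> < ereal C \<Longrightarrow>
      total_variation \<mu> \<le> ereal R"
    by (rule sublevel_total_variation_bound[of C]) blast
  obtain n0 where n0: "\<And>n. n \<ge> n0 \<Longrightarrow> objective f a (\<mu> n) < ereal C"
    using order_tendstoD(2)[OF lim C] by (auto simp: eventually_sequentially)
  define \<nu> where "\<nu> n = \<mu> (n + n0)" for n
  have \<nu>: "\<nu> n \<in> radon_measures V" for n by (simp add: \<nu>_def \<mu>)
  have \<nu>lim: "(\<lambda>n. objective f a (\<nu> n)) \<longlonglongrightarrow> primal_value f a V"
    unfolding \<nu>_def using lim by (rule LIMSEQ_ignore_initial_segment)
  have "\<bar>\<nu> n {v}\<bar> \<le> R" if "v \<in> V" for n v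
  proof -
    have "total_variation (\<nu> n) \<le> ereal R"
      using R[of "\<nu> n"] n0[of "n + n0"] \<nu>[of n] radon_measures_mono[OF V(2)] by (auto simp: \<nu>_def)
    then have "(\<Sum>v\<in>V. \<bar>\<nu> n {v}\<bar>) \<le> R"
      by (simp add: total_variation_finite_support[OF \<nu> V(1)])
    then show ?thesis using member_le_sum[of v V "\<lambda>v. \<bar>\<nu> n {v}\<bar>"] that V(1) by simp
  qed
  from pointwise_convergent_subsequence[where c = "\<lambda>n v. \<nu> n {v}", OF V(1) this]
  obtain r c where r: "strict_mono (r :: nat \<Rightarrow> nat)" and c: "\<And>v. v \<in> V \<Longrightarrow> (\<lambda>k. \<nu> (r k) {v}) \<longlonglongrightarrow> c v"
    by blast
  let ?\<nu> = "atomic_measure V c"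
  have in_V: "?\<nu> \<in> radon_measures V" by (rule atomic_measure_in_radon_measures[OF V(1)])
  have "objective f a ?\<nu> = ereal (\<Sum>v\<in>V. \<bar>c v\<bar>) + f (\<Sum>v\<in>V. c v *\<^sub>R sample a v)"
    by (simp add: objective_finite_support[OF in_V V] atomic_measure_singleton)
  also have "\<dots> \<le> primal_value f a V"
  proof (rule lower_semicontinuous_sum_le_limit[OF lsc_f minf])
    show "(\<lambda>k. \<Sum>v\<in>V. \<nu> (r k) {v} *\<^sub>R sample a v) \<longlonglongrightarrow> (\<Sum>v\<in>V. c v *\<^sub>R sample a v)"
      "(\<lambda>k. \<Sum>v\<in>V. \<bar>\<nu> (r k) {v}\<bar>) \<longlonglongrightarrow> (\<Sum>v\<in>V. \<bar>c v\<bar>)"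
      using c by (auto intro!: tendsto_intros)
    show "(\<lambda>k. ereal (\<Sum>v\<in>V. \<bar>\<nu> (r k) {v}\<bar>) + f (\<Sum>v\<in>V. \<nu> (r k) {v} *\<^sub>R sample a v))
        \<longlonglongrightarrow> primal_value f a V"
      using LIMSEQ_subseq_LIMSEQ[OF \<nu>lim r] by (simp add: o_def objective_finite_support[OF \<nu> V])
  qed
  finally have "objective f a ?\<nu> = primal_value f a V"
    using in_V unfolding primal_value_def by (intro antisym INF_lower)
  then show ?thesis using in_V by (auto simp: primal_solution_def)
qed

text \<open>
  The primal value is real: it is attained, and \<open>f\<close> omits \<open>-\<infinity>\<close>, while the Slater measure has a finite
  objective.
\<close>

lemma finite_duality:
  assumes V: "finite V" "V \<subseteq> unit_cube" and \<mu>0: "\<mu>0 \<in> radon_measures V"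
    and slater: "measurement a \<mu>0 \<in> interior (effective_domain f)"
  obtains p q where "primal_value f a V = ereal p" "dual_value f a V = ereal p"
    "dual_solution f a V q"
proof -
  obtain \<mu> where \<mu>: "\<mu> \<in> radon_measures V" "objective f a \<mu> = primal_value f a V"
    using finite_primal_solution_exists[OF V] by (auto simp: primal_solution_def)
  have "objective f a \<mu> \<noteq> -\<infinity>"
    using minf by (simp add: objective_finite_support[OF \<mu>(1) V])
  moreover have "f (measurement a \<mu>0) \<noteq> \<infinity>"
    using slater interior_subset by (auto simp: effective_domain_def)
  then have "objective f a \<mu>0 \<noteq> \<infinity>"
    using \<mu>0 by (auto simp: objective_def radon_measures_def)
  moreover have "primal_value f a V \<le> objective f a \<mu>0"
    unfolding primal_value_def using \<mu>0 by (rule INF_lower)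
  ultimately obtain p where p: "primal_value f a V = ereal p"
    using \<mu>(2) by (cases "primal_value f a V") auto
  have "ereal p \<le> ereal (\<Sum>v\<in>V. \<bar>c v\<bar>) + f (\<Sum>v\<in>V. c v *\<^sub>R sample a v)" for c
  proof -
    note c = atomic_measure_in_radon_measures[OF V(1), of c]
    have "primal_value f a V \<le> objective f a (atomic_measure V c)"
      unfolding primal_value_def using c by (rule INF_lower)
    then show ?thesis
      by (simp add: p objective_finite_support[OF c V] atomic_measure_singleton)
  qed
  then obtain q where q: "\<And>v. v \<in> V \<Longrightarrow> \<bar>q \<bullet> sample a v\<bar> \<le> 1" "fenchel_conjugate f q \<le> ereal (- p)"
    using finite_strong_duality[OF minf convex_f V(1), of p "sample a" "\<lambda>v. \<mu>0 {v}"]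
      slater measurement_finite_support[OF \<mu>0 V] by metis
  have feas: "q \<in> dual_feasible a V"
    using q(1) by (simp add: dual_feasible_iff adjoint_measurement_eq_inner)
  have "dual_value f a V \<le> ereal p"
    unfolding dual_value_def p[symmetric] by (intro SUP_least weak_duality_finite V)
  moreover have "ereal p \<le> - fenchel_conjugate f q"
    using q(2) by (cases "fenchel_conjugate f q") auto
  moreover have "- fenchel_conjugate f q \<le> dual_value f a V"
    unfolding dual_value_def using feas by (rule SUP_upper)
  ultimately have "dual_value f a V = ereal p" "- fenchel_conjugate f q = dual_value f a V"
    by (auto intro: antisym order_trans)
  then show ?thesis using p feas that by (simp add: dual_solution_def)
qed

end

section \<open>Dyadic refinement\<close>

lemma dyadic_cube_eq_iff:
  "dyadic_cube j (x :: real^'d::finite) = dyadic_cube k y \<longleftrightarrow> j = k \<and> x = y"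
proof
  have ne: "cbox x (x + (1 / 2 ^ j) *\<^sub>R 1) \<noteq> {}" for j and x :: "real^'d"
    by (simp add: interval_ne_empty_cart)
  assume "dyadic_cube j x = dyadic_cube k y"
  then have e: "x = y" "x + (1 / 2 ^ j) *\<^sub>R 1 = y + (1 / 2 ^ k) *\<^sub>R 1"
    using ne unfolding dyadic_cube_def by (auto simp: eq_cbox)
  then have "(1 / 2 ^ j :: real) = 1 / 2 ^ k" by (simp add: vec_eq_iff)
  then have "j = k" by simp
  with e show "j = k \<and> x = y" by simp
qed simp

lemma dyadic_cube_bounded: "bounded (dyadic_cube j x)"
  by (simp add: dyadic_cube_def)

lemma corner_in_dyadic_cube: "x \<in> dyadic_cube j x"
  by (simp add: dyadic_cube_def mem_box_cart)

lemma diameter_dyadic_cube: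
  "diameter (dyadic_cube j (x :: real^'d::finite)) = norm (1 :: real^'d) / 2 ^ j"
proof -
  have "diameter (dyadic_cube j x) = dist x (x + (1 / 2 ^ j) *\<^sub>R 1)"
    unfolding dyadic_cube_def by (intro diameter_cbox) (simp add: inner_add_left Basis_vec_def inner_axis)
  then show ?thesis by (simp add: dist_norm)
qed

lemma cell_vertices_dyadic_cube:
  "cell_vertices (dyadic_cube j x) = {v. \<forall>i. v $ i = x $ i \<or> v $ i = x $ i + 1 / 2 ^ j}"
  unfolding cell_vertices_def by (auto simp: dyadic_cube_eq_iff)

lemma subcells_dyadic_cube:
  "subcells (dyadic_cube j x) =
    dyadic_cube (Suc j) ` {v. \<forall>i. v $ i = x $ i \<or> v $ i = x $ i + 1 / 2 ^ Suc j}"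
  unfolding subcells_def by (auto simp: dyadic_cube_eq_iff)

text \<open>
  The set consists of the corners of a cube with edge \<open>h\<close>. They are indexed by the coordinates that
  take the upper value.
\<close>

lemma corner_choices:
  fixes x :: "real^'d::finite" and h :: real
  defines "X \<equiv> {v. \<forall>i. v $ i = x $ i \<or> v $ i = x $ i + h}"
  shows "finite X" "card X \<le> 2 ^ CARD('d)"
proof -
  let ?g = "\<lambda>A. (\<chi> i. x $ i + (if i \<in> A then h else 0)) :: real^'d"
  have "X \<subseteq> ?g ` UNIV"
  proof
    fix v assume "v \<in> X"
    then have "v = ?g {i. v $ i = x $ i + h}" by (auto simp: X_def vec_eq_iff)
    then show "v \<in> ?g ` UNIV" by blast
  qed
  then show "finite X" "card X \<le> 2 ^ CARD('d)"
    using finite_subset[of X "?g ` UNIV"] card_mono[of "?g ` UNIV" X]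
      card_image_le[of "UNIV :: 'd set set" ?g] card_Pow[of "UNIV :: 'd set"] by auto
qed

lemma finite_subcells: "finite (subcells (dyadic_cube j x))"
  and card_subcells: "card (subcells (dyadic_cube j (x :: real^'d::finite))) \<le> 2 ^ CARD('d)"
  unfolding subcells_dyadic_cube using corner_choices[of x "1 / 2 ^ Suc j"]
  by (auto intro: order_trans[OF card_image_le])

lemma dyadic_cellsE:
  assumes "\<omega> \<in> dyadic_cells"
  obtains j x where "\<omega> = dyadic_cube j x" "\<And>i. \<exists>n::nat. n < 2 ^ j \<and> x $ i = real n / 2 ^ j"
  using assms unfolding dyadic_cells_def by auto

lemma subcells_subset_dyadic_cells:
  assumes "\<omega> \<in> dyadic_cells"
  shows "subcells \<omega> \<subseteq> dyadic_cells"
proof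
  fix \<omega>' assume "\<omega>' \<in> subcells \<omega>"
  obtain j x where \<omega>: "\<omega> = dyadic_cube j x" and n: "\<And>i. \<exists>n::nat. n < 2 ^ j \<and> x $ i = real n / 2 ^ j"
    using dyadic_cellsE[OF assms] by metis
  obtain v where \<omega>': "\<omega>' = dyadic_cube (Suc j) v" and v: "\<And>i. v $ i = x $ i \<or> v $ i = x $ i + 1 / 2 ^ Suc j"
    using \<open>\<omega>' \<in> subcells \<omega>\<close> unfolding \<omega> subcells_dyadic_cube by auto
  have "\<exists>n::nat. n < 2 ^ Suc j \<and> v $ i = real n / 2 ^ Suc j" for i
  proof -
    obtain n where n: "n < 2 ^ j" "x $ i = real n / 2 ^ j" using n by metis
    from v[of i] show ?thesis
    proof
      assume "v $ i = x $ i"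
      then show ?thesis using n by (intro exI[of _ "2 * n"]) simp
    next
      assume "v $ i = x $ i + 1 / 2 ^ Suc j"
      then show ?thesis using n by (intro exI[of _ "2 * n + 1"]) (auto simp: field_simps)
    qed
  qed
  then show "\<omega>' \<in> dyadic_cells" unfolding dyadic_cells_def \<omega>' by blast
qed

lemma cell_vertices_subset_unit_cube:
  assumes "\<omega> \<in> dyadic_cells"
  shows "cell_vertices \<omega> \<subseteq> unit_cube"
proof
  fix v assume "v \<in> cell_vertices \<omega>"
  obtain j x where \<omega>: "\<omega> = dyadic_cube j x" and n: "\<And>i. \<exists>n::nat. n < 2 ^ j \<and> x $ i = real n / 2 ^ j"
    using dyadic_cellsE[OF assms] by metis
  have "0 \<le> v $ i \<and> v $ i \<le> 1" for i
  proof -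
    obtain n where n: "n < 2 ^ j" "x $ i = real n / 2 ^ j" using n by metis
    have "real (Suc n) \<le> real (2 ^ j)" using n(1) by (intro of_nat_mono) simp
    then have "real (Suc n) / 2 ^ j \<le> 1" by simp
    moreover have "real n / 2 ^ j \<le> 1" using n(1) by simp
    moreover have "v $ i = x $ i \<or> v $ i = x $ i + 1 / 2 ^ j"
      using \<open>v \<in> cell_vertices \<omega>\<close> unfolding \<omega> cell_vertices_dyadic_cube by blast
    then have "v $ i = real n / 2 ^ j \<or> v $ i = real (Suc n) / 2 ^ j"
      using n(2) by (simp add: add_divide_distrib add.commute)
    ultimately show ?thesis by (auto simp del: of_nat_Suc)
  qed
  then show "v \<in> unit_cube" by (simp add: unit_cube_def mem_box_cart)
qed

lemma finite_cell_vertices: "\<omega> \<in> dyadic_cells \<Longrightarrow> finite (cell_vertices \<omega>)"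
  by (elim dyadic_cellsE) (simp add: cell_vertices_dyadic_cube corner_choices)

text \<open>
  The subcell in the corner of a vertex keeps that vertex. Thus refinement never loses vertices.
\<close>

lemma cell_vertices_subset_subcells:
  assumes "\<omega> \<in> dyadic_cells"
  shows "cell_vertices \<omega> \<subseteq> partition_vertices (subcells \<omega>)"
proof
  fix v assume v: "v \<in> cell_vertices \<omega>"
  obtain j x where \<omega>: "\<omega> = dyadic_cube j x" using dyadic_cellsE[OF assms] by metis
  \<comment> \<open>the lower corner of the subcell at the vertex \<open>v\<close>\<close>
  let ?w = "\<chi> i. if v $ i = x $ i then x $ i else x $ i + 1 / 2 ^ Suc j"
  have "dyadic_cube (Suc j) ?w \<in> subcells \<omega>"
    unfolding \<omega> subcells_dyadic_cube by auto
  moreover have "v \<in> cell_vertices (dyadic_cube (Suc j) ?w)"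
  proof -
    have "x $ i + 1 / 2 ^ j = x $ i + 1 / 2 ^ Suc j + 1 / 2 ^ Suc j" for i by simp
    then have "v $ i = ?w $ i \<or> v $ i = ?w $ i + 1 / 2 ^ Suc j" for i
      using v unfolding \<omega> cell_vertices_dyadic_cube by (auto simp del: power_Suc)
    then show ?thesis unfolding cell_vertices_dyadic_cube by blast
  qed
  ultimately show "v \<in> partition_vertices (subcells \<omega>)"
    unfolding partition_vertices_def by blast
qed

lemma largest_cells_subset: "largest_cells C \<subseteq> C"
  by (auto simp: largest_cells_def)

lemma refine_invariants:
  assumes "finite W" "W \<subseteq> dyadic_cells" "C \<subseteq> W"
  shows "finite (refine W C)" "refine W C \<subseteq> dyadic_cells"
    "partition_vertices W \<subseteq> partition_vertices (refine W C)"
proof -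
  have L: "largest_cells C \<subseteq> W" using largest_cells_subset assms(3) by blast
  have "finite (subcells \<omega>)" if "\<omega> \<in> W" for \<omega>
    using that assms(2) dyadic_cellsE[of \<omega>] finite_subcells by (metis subsetD)
  then show "finite (refine W C)"
    unfolding refine_def using L assms(1) finite_subset[OF L] by blast
  show "refine W C \<subseteq> dyadic_cells"
    unfolding refine_def using L assms(2) subcells_subset_dyadic_cells by blast
  show "partition_vertices W \<subseteq> partition_vertices (refine W C)"
  proof
    fix v assume "v \<in> partition_vertices W"
    then obtain \<omega> where \<omega>: "\<omega> \<in> W" "v \<in> cell_vertices \<omega>" by (auto simp: partition_vertices_def)
    show "v \<in> partition_vertices (refine W C)"
    proof (cases "\<omega> \<in> largest_cells C")
      case True
      then show ?thesis
        using cell_vertices_subset_subcells[of \<omega>] \<omega> assms(2)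
        unfolding partition_vertices_def refine_def by blast
    next
      case False
      then show ?thesis using \<omega> unfolding partition_vertices_def refine_def by blast
    qed
  qed
qed

lemma partition_vertices_finite_subset:
  assumes "finite W" "W \<subseteq> dyadic_cells"
  shows "finite (partition_vertices W)" "partition_vertices W \<subseteq> unit_cube"
  using assms finite_cell_vertices cell_vertices_subset_unit_cube
  unfolding partition_vertices_def by blast+

definition cell_level :: "(real^'d) set \<Rightarrow> nat" where
  "cell_level \<omega> = (THE j. \<exists>x. \<omega> = dyadic_cube j x)"

lemma cell_level_dyadic_cube [simp]: "cell_level (dyadic_cube j x) = j"
  unfolding cell_level_def by (rule the_equality) (auto simp: dyadic_cube_eq_iff)

text \<open>
  A potential for termination up to level \<open>j\<close>. The base exceeds the number \<open>2 ^ D\<close> of subcells, so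
  replacing a cell of level at most \<open>j\<close> by all its subcells decreases the total weight. Finer cells
  weigh nothing.
\<close>

definition cell_weight :: "nat \<Rightarrow> (real^'d) set \<Rightarrow> nat" where
  "cell_weight j \<omega> =
    (if cell_level \<omega> \<le> j then (2 ^ CARD('d) + 1) ^ (Suc j - cell_level \<omega>) else 0)"

lemma cell_weight_subcells:
  assumes "\<omega> \<in> dyadic_cells"
  shows "(\<Sum>\<omega>'\<in>subcells \<omega>. cell_weight j \<omega>') + of_bool (cell_level \<omega> \<le> j) \<le>
    cell_weight j (\<omega> :: (real^'d::finite) set)"
proof -
  obtain l x where \<omega>: "\<omega> = dyadic_cube l x" using dyadic_cellsE[OF assms] by metis
  let ?B = "2 ^ CARD('d) + 1 :: nat"
  have lev: "cell_level \<omega>' = Suc l" if "\<omega>' \<in> subcells \<omega>" for \<omega>'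
    using that unfolding \<omega> subcells_dyadic_cube by auto
  show ?thesis
  proof (cases "l \<le> j")
    case True
    have "(\<Sum>\<omega>'\<in>subcells \<omega>. cell_weight j \<omega>') \<le> (\<Sum>\<omega>'\<in>subcells \<omega>. ?B ^ (j - l))"
      by (intro sum_mono) (simp add: cell_weight_def lev)
    also have "\<dots> \<le> 2 ^ CARD('d) * ?B ^ (j - l)"
      using card_subcells[of l x] by (simp add: \<omega>)
    also have "\<dots> + 1 \<le> ?B ^ (Suc j - l)"
      using True by (simp add: Suc_diff_le)
    finally show ?thesis using True by (simp add: \<omega> cell_weight_def)
  next
    case False
    then show ?thesis by (simp add: cell_weight_def lev \<omega>)
  qed
qed

text \<open>
  Each largest candidate of level at most \<open>j\<close> costs at least 1. New cells that coincide with old ones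
  only lower the sum.
\<close>

lemma sum_weight_refine:
  assumes W: "finite W" "W \<subseteq> dyadic_cells" "C \<subseteq> (W :: (real^'d::finite) set set)"
  shows "(\<Sum>\<omega>\<in>refine W C. cell_weight j \<omega>) + (\<Sum>\<omega>\<in>largest_cells C. of_bool (cell_level \<omega> \<le> j)) \<le>
    (\<Sum>\<omega>\<in>W. cell_weight j \<omega>)"
proof -
  let ?L = "largest_cells C" and ?w = "cell_weight j"
  have L: "?L \<subseteq> W" using largest_cells_subset W(3) by blast
  then have finL: "finite ?L" using W(1) finite_subset by blast
  have fs: "finite (subcells \<omega>)" if "\<omega> \<in> W" for \<omega>
    using that W(2) dyadic_cellsE[of \<omega>] finite_subcells by (metis subsetD)
  have "(\<Sum>\<omega>\<in>refine W C. ?w \<omega>) \<le> (\<Sum>\<omega>\<in>W - ?L. ?w \<omega>) + (\<Sum>\<omega>'\<in>(\<Union>\<omega>\<in>?L. subcells \<omega>). ?w \<omega>')"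
    unfolding refine_def using W(1) finL fs L by (subst sum_Un_nat) auto
  also have "(\<Sum>\<omega>'\<in>(\<Union>\<omega>\<in>?L. subcells \<omega>). ?w \<omega>') \<le> (\<Sum>\<omega>\<in>?L. \<Sum>\<omega>'\<in>subcells \<omega>. ?w \<omega>')"
  proof -
    have "(\<Sum>\<omega>'\<in>(\<Union>\<omega>\<in>?L. subcells \<omega>). ?w \<omega>') =
        (\<Sum>\<omega>'\<in>snd ` (SIGMA \<omega>:?L. subcells \<omega>). ?w \<omega>')"
      by (rule sum.cong) force+
    also have "\<dots> \<le> sum (?w \<circ> snd) (SIGMA \<omega>:?L. subcells \<omega>)"
      using finL fs L by (intro sum_image_le) auto
    also have "\<dots> = (\<Sum>\<omega>\<in>?L. \<Sum>\<omega>'\<in>subcells \<omega>. ?w \<omega>')"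
      using finL fs L by (subst sum.Sigma) (auto simp: case_prod_unfold o_def)
    finally show ?thesis .
  qed
  finally have 1: "(\<Sum>\<omega>\<in>refine W C. ?w \<omega>) \<le>
      (\<Sum>\<omega>\<in>W - ?L. ?w \<omega>) + (\<Sum>\<omega>\<in>?L. \<Sum>\<omega>'\<in>subcells \<omega>. ?w \<omega>')"
    by simp
  have 2: "(\<Sum>\<omega>\<in>?L. (\<Sum>\<omega>'\<in>subcells \<omega>. ?w \<omega>') + of_bool (cell_level \<omega> \<le> j)) \<le> (\<Sum>\<omega>\<in>?L. ?w \<omega>)"
    using L W(2) by (intro sum_mono cell_weight_subcells) auto
  have 3: "(\<Sum>\<omega>\<in>W. ?w \<omega>) = (\<Sum>\<omega>\<in>W - ?L. ?w \<omega>) + (\<Sum>\<omega>\<in>?L. ?w \<omega>)"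
    using sum.subset_diff[OF L W(1), of ?w] .
  show ?thesis using 1 2 3 by (simp only: sum.distrib)
qed

text \<open>
  The diameter decreases with the level, so a candidate of least level is a largest one.
\<close>

lemma largest_cells_coarse:
  assumes "finite C" "C \<subseteq> dyadic_cells" "\<omega> \<in> C"
  obtains \<omega>' where "\<omega>' \<in> largest_cells C" "cell_level \<omega>' \<le> cell_level (\<omega> :: (real^'d::finite) set)"
proof -
  obtain \<omega>' where \<omega>': "\<omega>' \<in> C" "\<And>z. z \<in> C \<Longrightarrow> cell_level \<omega>' \<le> cell_level z"
    using ex_has_least_nat[of "\<lambda>z. z \<in> C" \<omega> cell_level] assms(3) by blast
  have diam: "diameter z = norm (1 :: real^'d) / 2 ^ cell_level z" if "z \<in> C" for z
    using dyadic_cellsE[of z] that assms(2) by (metis subsetD diameter_dyadic_cube cell_level_dyadic_cube)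
  have "diameter z \<le> diameter \<omega>'" if "z \<in> C" for z
    using \<omega>'(2)[OF that] diam[OF that] diam[OF \<omega>'(1)] by (auto intro!: divide_left_mono)
  then show ?thesis using that \<omega>' assms(3) by (auto simp: largest_cells_def)
qed

text \<open>
  Subdividing a cell of level at most \<open>j\<close> strictly decreases the total weight, which is a natural
  number and never increases. So from some step on the largest candidates, and then all candidates,
  are of level more than \<open>j\<close>.
\<close>

lemma candidate_cells_shrink:
  fixes W C :: "nat \<Rightarrow> (real^'d::finite) set set"
  assumes W: "\<And>k. finite (W k)" "\<And>k. W k \<subseteq> dyadic_cells" "\<And>k. C k \<subseteq> W k"
    and ref: "\<And>k. W (Suc k) = refine (W k) (C k)" and e: "0 < e"
  shows "\<forall>\<^sub>F k in sequentially. \<forall>\<omega>\<in>C k. diameter \<omega> < e"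
proof -
  obtain j where j: "norm (1 :: real^'d) / e < 2 ^ j"
    using real_arch_pow[of 2 "norm (1 :: real^'d) / e"] by auto
  let ?P = "\<lambda>k. \<Sum>\<omega>\<in>W k. cell_weight j \<omega>"
  obtain k0 where k0: "\<And>k. ?P k0 \<le> ?P k"
    using ex_has_least_nat[of "\<lambda>_. True" 0 ?P] by blast
  have step: "?P (Suc k) + (\<Sum>\<omega>\<in>largest_cells (C k). of_bool (cell_level \<omega> \<le> j)) \<le> ?P k" for k
    using sum_weight_refine[OF W] by (simp add: ref)
  have const: "?P k = ?P k0" if "k \<ge> k0" for k
  proof -
    have "decseq ?P" using step by (intro decseq_SucI) (metis add_leD1)
    then show ?thesis using decseqD[of ?P k0 k] that k0[of k] by linarith
  qed
  have zero: "(\<Sum>\<omega>\<in>largest_cells (C k). of_bool (cell_level \<omega> \<le> j)) = (0::nat)" if "k \<ge> k0" for k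
    using step[of k] const[OF that] const[of "Suc k"] that by linarith
  have fin: "finite (C k)" "C k \<subseteq> dyadic_cells" for k
    using finite_subset[OF W(3) W(1)] order_trans[OF W(3) W(2)] by auto
  have finL: "finite (largest_cells (C k))" for k
    using finite_subset[OF largest_cells_subset fin(1)] .
  have fine: "j < cell_level \<omega>" if "k \<ge> k0" "\<omega> \<in> largest_cells (C k)" for k \<omega>
    using zero[OF that(1)] that(2) finL[of k] by (auto simp: not_le)
  have "diameter \<omega> < e" if "k \<ge> k0" "\<omega> \<in> C k" for k \<omega>
  proof -
    note in_C = that(2)
    obtain \<omega>' where "\<omega>' \<in> largest_cells (C k)" "cell_level \<omega>' \<le> cell_level \<omega>"
      by (rule largest_cells_coarse[OF fin in_C])
    then have "j < cell_level \<omega>" using fine[OF that(1)] by fastforce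
    then have "(2::real) ^ j \<le> 2 ^ cell_level \<omega>" by (intro power_increasing) auto
    with j have "norm (1 :: real^'d) / e < 2 ^ cell_level \<omega>" by linarith
    moreover have "diameter \<omega> = norm (1 :: real^'d) / 2 ^ cell_level \<omega>"
      using dyadic_cellsE[of \<omega>] that fin by (metis subsetD diameter_dyadic_cube cell_level_dyadic_cube)
    ultimately show ?thesis using e
      by (simp only: pos_divide_less_eq zero_less_power zero_less_numeral) (simp add: mult.commute)
  qed
  then show ?thesis unfolding eventually_sequentially by blast
qed

section \<open>Convergence of the refinement algorithm\<close>

lemma refinement_invariants:
  fixes W :: "nat \<Rightarrow> (real^'d::finite) set set"
  assumes W0: "finite (W 0)" "W 0 \<subseteq> dyadic_cells"
    and step: "\<And>k. k < n \<Longrightarrow> C k \<subseteq> W k" "\<And>k. k < n \<Longrightarrow> W (Suc k) = refine (W k) (C k)"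
    and "k \<le> n"
  shows "finite (W k) \<and> W k \<subseteq> dyadic_cells \<and> partition_vertices (W 0) \<subseteq> partition_vertices (W k)"
  using \<open>k \<le> n\<close>
proof (induction k)
  case (Suc k)
  then have IH: "finite (W k)" "W k \<subseteq> dyadic_cells"
      "partition_vertices (W 0) \<subseteq> partition_vertices (W k)" and "k < n" by auto
  from refine_invariants[OF IH(1,2) step(1)[OF \<open>k < n\<close>]] IH(3) step(2)[OF \<open>k < n\<close>]
  show ?case by (metis order_trans)
qed (use W0 in auto)

lemma tendsto_if_subsequences:
  fixes X :: "nat \<Rightarrow> 'a::topological_space"
  assumes "\<And>s. strict_mono (s :: nat \<Rightarrow> nat) \<Longrightarrow>
    \<exists>r. strict_mono (r :: nat \<Rightarrow> nat) \<and> (\<lambda>k. X (s (r k))) \<longlonglongrightarrow> l"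
  shows "X \<longlonglongrightarrow> l"
proof (rule topological_tendstoI, rule ccontr)
  fix S assume S: "open S" "l \<in> S" "\<not> (\<forall>\<^sub>F k in sequentially. X k \<in> S)"
  then obtain s where s: "strict_mono (s :: nat \<Rightarrow> nat)" "\<And>n. X (s n) \<notin> S"
    using not_eventually_sequentiallyD by metis
  then obtain r :: "nat \<Rightarrow> nat" where "(\<lambda>k. X (s (r k))) \<longlonglongrightarrow> l" using assms by metis
  from topological_tendstoD[OF this S(1,2)] s(2) show False by simp
qed

lemma LIMSEQ_subsubseq:
  fixes s r :: "nat \<Rightarrow> nat"
  assumes "X \<longlonglongrightarrow> l" "strict_mono s" "strict_mono r"
  shows "(\<lambda>k. X (s (r k))) \<longlonglongrightarrow> l"
  using LIMSEQ_subseq_LIMSEQ[OF LIMSEQ_subseq_LIMSEQ[OF assms(1,2)] assms(3)] by (simp add: o_def)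

locale refinement_run = measurement_problem f a
  for f :: "real^'m::finite \<Rightarrow> ereal" and a :: "'m \<Rightarrow> real^'d::finite \<Rightarrow> real" +
  fixes W C :: "nat \<Rightarrow> (real^'d) set set" and \<mu> :: "nat \<Rightarrow> (real^'d) set \<Rightarrow> real"
    and q :: "nat \<Rightarrow> real^'m" and \<mu>0 :: "(real^'d) set \<Rightarrow> real"
  assumes W0: "finite (W 0)" "W 0 \<subseteq> dyadic_cells"
    and step: "\<And>k. refinement_step f a (W k) (\<mu> k) (q k) (C k) (W (Suc k))"
    and candidates: "\<And>k. large_local_maximizers a (q k) \<subseteq> \<Union>(C k)"
    and \<mu>0: "\<mu>0 \<in> radon_measures (partition_vertices (W 0))"
    and slater: "measurement a \<mu>0 \<in> interior (effective_domain f)"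
begin

abbreviation V where "V k \<equiv> partition_vertices (W k)"

definition opt_value where "opt_value k = real_of_ereal (primal_value f a (V k))"

lemma C_subset: "C k \<subseteq> W k" and W_Suc: "W (Suc k) = refine (W k) (C k)"
  and \<mu>_solution: "primal_solution f a (V k) (\<mu> k)" and q_solution: "dual_solution f a (V k) (q k)"
  using step[of k] by (auto simp: refinement_step_def)

lemma W: "finite (W k)" "W k \<subseteq> dyadic_cells" and V0_subset: "V 0 \<subseteq> V k"
  using refinement_invariants[where W=W and C=C and n=k and k=k, OF W0 C_subset W_Suc] by auto

lemma V: "finite (V k)" "V k \<subseteq> unit_cube"
  using partition_vertices_finite_subset[OF W] by auto

lemma V_Suc: "V k \<subseteq> V (Suc k)"
  using refine_invariants(3)[OF W C_subset] by (simp add: W_Suc)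

lemma \<mu>0_in: "\<mu>0 \<in> radon_measures (V k)"
  using \<mu>0 radon_measures_mono[OF V0_subset] by blast

lemma \<mu>_in: "\<mu> k \<in> radon_measures (V k)" "\<mu> k \<in> radon_measures unit_cube"
  using \<mu>_solution radon_measures_mono[OF V(2)] by (auto simp: primal_solution_def)

lemma q_feasible: "q k \<in> dual_feasible a (V k)"
  using q_solution by (simp add: dual_solution_def)

lemma primal_value_eq: "primal_value f a (V k) = ereal (opt_value k)"
  and dual_value_eq: "dual_value f a (V k) = ereal (opt_value k)"
  by (rule finite_duality[OF V[of k] \<mu>0_in[of k] slater]; simp add: opt_value_def)+

lemma objective_eq: "objective f a (\<mu> k) = ereal (opt_value k)"
  using \<mu>_solution by (simp add: primal_solution_def primal_value_eq)

lemma conjugate_eq: "fenchel_conjugate f (q k) = ereal (- opt_value k)"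
  using q_solution unfolding dual_solution_def dual_value_eq
  by (metis ereal_uminus_uminus uminus_ereal.simps(1))

lemma decseq_opt_value: "decseq opt_value"
proof (rule decseq_SucI)
  fix k
  have "primal_value f a (V (Suc k)) \<le> primal_value f a (V k)"
    unfolding primal_value_def by (intro INF_superset_mono radon_measures_mono V_Suc) auto
  then show "opt_value (Suc k) \<le> opt_value k" by (simp add: primal_value_eq)
qed

lemma \<mu>_bounded: obtains R where "\<And>k. total_variation (\<mu> k) \<le> ereal R"
proof (rule sublevel_total_variation_bound[of "opt_value 0 + 1"])
  fix R assume R: "\<And>\<mu>. \<mu> \<in> radon_measures unit_cube \<Longrightarrow> objective f a \<mu> < ereal (opt_value 0 + 1) \<Longrightarrow>
    total_variation \<mu> \<le> ereal R"
  have "objective f a (\<mu> k) < ereal (opt_value 0 + 1)" for k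
    using decseqD[OF decseq_opt_value, of 0 k] by (simp add: objective_eq)
  then show thesis using that R \<mu>_in(2) by blast
qed

text \<open>
  The bound \<open>P\<close> ranges over the extended reals because the lemma is also what shows that the optimal
  values are bounded below.
\<close>

lemma primal_cluster_point:
  assumes s: "strict_mono (s :: nat \<Rightarrow> nat)" and P: "(\<lambda>k. ereal (opt_value k)) \<longlonglongrightarrow> P"
  obtains r \<nu> where "strict_mono r" "\<nu> \<in> radon_measures unit_cube"
    "weak_star_converges unit_cube (\<lambda>k. \<mu> (s (r k))) \<nu>" "objective f a \<nu> \<le> P"
proof -
  obtain R where R: "\<And>k. total_variation (\<mu> k) \<le> ereal R" by (rule \<mu>_bounded) blast
  obtain r \<nu> t T where r: "strict_mono r" and \<nu>: "\<nu> \<in> radon_measures unit_cube"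
    and lim: "\<And>\<phi>. continuous_on unit_cube \<phi> \<Longrightarrow>
      (\<lambda>k. signed_integral unit_cube (\<mu> (s (r k))) \<phi>) \<longlonglongrightarrow> signed_integral unit_cube \<nu> \<phi>"
    and t: "\<And>k. total_variation (\<mu> (s (r k))) = ereal (t k)" "t \<longlonglongrightarrow> T" "total_variation \<nu> \<le> ereal T"
    by (rule finite_support_weak_star_compact[of "\<lambda>k. V (s k)" "\<lambda>k. \<mu> (s k)" R, OF V \<mu>_in(1) R]) blast
  have "objective f a \<nu> \<le> ereal T + f (measurement a \<nu>)"
    unfolding objective_def using t(3) by (rule add_right_mono)
  also have "\<dots> \<le> P"
  proof (rule lower_semicontinuous_sum_le_limit[OF lsc_f minf _ t(2)])
    show "(\<lambda>k. measurement a (\<mu> (s (r k)))) \<longlonglongrightarrow> measurement a \<nu>"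
      using lim[OF continuous_a] by (intro vec_tendstoI) (simp add: measurement_def)
    have "objective f a (\<mu> (s (r k))) = ereal (t k) + f (measurement a (\<mu> (s (r k))))" for k
      by (simp add: objective_def t(1))
    then show "(\<lambda>k. ereal (t k) + f (measurement a (\<mu> (s (r k))))) \<longlonglongrightarrow> P"
      using LIMSEQ_subsubseq[OF P s r] by (simp add: objective_eq)
  qed
  finally have "objective f a \<nu> \<le> P" .
  moreover have "weak_star_converges unit_cube (\<lambda>k. \<mu> (s (r k))) \<nu>"
    using lim by (simp add: weak_star_converges_def C0_functions_def)
  ultimately show ?thesis using that r \<nu> by blast
qed

text \<open>
  The optimal values decrease. Their infimum is not \<open>-\<infinity>\<close>, because it is bounded below by the objective
  of a cluster point.
\<close>

lemma opt_value_convergent: obtains l where "opt_value \<longlonglongrightarrow> l" "\<And>k. l \<le> opt_value k"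
proof -
  have dec: "decseq (\<lambda>k. ereal (opt_value k))" using decseq_opt_value by (simp add: decseq_def)
  have lim: "(\<lambda>k. ereal (opt_value k)) \<longlonglongrightarrow> (INF k. ereal (opt_value k))" by (rule LIMSEQ_INF[OF dec])
  obtain r \<nu> where "objective f a \<nu> \<le> (INF k. ereal (opt_value k))"
    by (rule primal_cluster_point[OF strict_mono_id lim]) blast
  moreover have "objective f a \<nu> \<noteq> -\<infinity>"
    using minf[of "measurement a \<nu>"] total_variation_nonneg[of \<nu>]
    by (cases "total_variation \<nu>"; cases "f (measurement a \<nu>)") (auto simp: objective_def)
  moreover have "(INF k. ereal (opt_value k)) \<le> ereal (opt_value 0)" by (rule INF_lower) simp
  ultimately obtain l where l: "(INF k. ereal (opt_value k)) = ereal l"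
    by (cases "INF k. ereal (opt_value k)") auto
  have "ereal l \<le> ereal (opt_value k)" for k unfolding l[symmetric] by (rule INF_lower) simp
  then show ?thesis using that[of l] lim by (simp add: l)
qed

text \<open>
  The conjugate is bounded above along \<open>q\<close> because the optimal values are bounded below. It grows linearly
  in the norm, up to the pairing with the Slater measurement, and feasibility bounds this pairing
  from below.
\<close>

lemma q_bounded: obtains B where "0 < B" "\<And>k. norm (q k) \<le> B"
proof -
  obtain l where l: "\<And>k. l \<le> opt_value k" by (rule opt_value_convergent) blast
  obtain r K where r: "0 < r"
    and K: "\<And>z. ereal (z \<bullet> measurement a \<mu>0 + r * norm z - K) \<le> fenchel_conjugate f z"
    by (rule interior_domain_imp_conjugate_coercive[OF minf convex_f slater]) blast
  obtain T where T: "total_variation \<mu>0 = ereal T" by (rule total_variation_real[OF \<mu>0])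
  have "norm (q k) \<le> (K + T - l) / r" for k
  proof -
    have "- T \<le> q k \<bullet> measurement a \<mu>0"
      by (rule inner_measurement_ge_finite[OF \<mu>0_in V q_feasible T])
    moreover have "q k \<bullet> measurement a \<mu>0 + r * norm (q k) - K \<le> - opt_value k"
      using K[of "q k"] by (simp add: conjugate_eq)
    ultimately have "r * norm (q k) \<le> K + T - l" using l[of k] by simp
    then show ?thesis using r by (simp add: field_simps)
  qed
  then show ?thesis using that[of "max 1 ((K + T - l) / r)"] by (simp add: le_max_iff_disj)
qed

text \<open>
  A maximizer \<open>x\<close> of \<open>|A*q k|\<close> over the cube with a value of at least 1 is a large local maximizer. Hence
  \<open>x\<close> lies in a small candidate cell, whose corner \<open>z\<close> is a vertex and satisfies \<open>|A*q k z| \<le> 1\<close>.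
\<close>

lemma nearly_feasible:
  assumes e: "0 < e"
  shows "\<forall>\<^sub>F k in sequentially. \<forall>x\<in>unit_cube. \<bar>adjoint_measurement a (q k) x\<bar> \<le> 1 + e"
proof -
  obtain B where B: "0 < B" "\<And>k. norm (q k) \<le> B" by (rule q_bounded) blast
  have "continuous_on unit_cube (sample a)"
    unfolding sample_def[abs_def] by (intro continuous_on_vec_lambda continuous_a)
  then have "uniformly_continuous_on unit_cube (sample a)"
    by (intro compact_uniformly_continuous) (simp_all add: unit_cube_def)
  then obtain d where d: "0 < d" "\<And>x y. x \<in> unit_cube \<Longrightarrow> y \<in> unit_cube \<Longrightarrow> dist x y < d \<Longrightarrow>
      dist (sample a x) (sample a y) < e / B"
    using e B(1) unfolding uniformly_continuous_on_def by (metis divide_pos_pos dist_commute)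
  have "\<forall>\<^sub>F k in sequentially. \<forall>\<omega>\<in>C k. diameter \<omega> < d"
    by (rule candidate_cells_shrink[of W C, OF W C_subset W_Suc d(1)])
  then show ?thesis
  proof eventually_elim
    case (elim k)
    let ?g = "adjoint_measurement a (q k)"
    have "unit_cube \<noteq> ({} :: (real^'d) set)" by (simp add: unit_cube_def interval_ne_empty_cart)
    moreover have "compact (unit_cube :: (real^'d) set)" by (simp add: unit_cube_def)
    moreover have "continuous_on unit_cube (\<lambda>x. \<bar>?g x\<bar>)"
      by (intro continuous_intros continuous_adjoint_measurement)
    ultimately obtain x where x: "x \<in> unit_cube" "\<And>y. y \<in> unit_cube \<Longrightarrow> \<bar>?g y\<bar> \<le> \<bar>?g x\<bar>"
      using continuous_attains_sup by metis
    have "\<bar>?g x\<bar> \<le> 1 + e"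
    proof (cases "1 \<le> \<bar>?g x\<bar>")
      case True
      then have "x \<in> large_local_maximizers a (q k)"
        using x by (auto simp: large_local_maximizers_def eventually_at_filter)
      then obtain \<omega> where \<omega>: "\<omega> \<in> C k" "x \<in> \<omega>" using candidates by blast
      then have "\<omega> \<in> W k" using C_subset by blast
      then have "\<omega> \<in> dyadic_cells" using W(2) by blast
      then obtain j z where z: "\<omega> = dyadic_cube j z" by (rule dyadic_cellsE)
      then have "z \<in> V k"
        using \<open>\<omega> \<in> W k\<close> by (auto simp: partition_vertices_def cell_vertices_dyadic_cube intro!: bexI[of _ \<omega>])
      have "dist x z \<le> diameter \<omega>"
        using \<omega>(2) z by (intro diameter_bounded_bound) (auto simp: dyadic_cube_bounded corner_in_dyadic_cube)
      then have "dist x z < d" using elim \<omega>(1) by fastforce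
      then have "norm (sample a x - sample a z) < e / B"
        using d(2)[of x z] x(1) \<open>z \<in> V k\<close> V(2) by (auto simp: dist_norm)
      have "\<bar>?g x - ?g z\<bar> \<le> norm (q k) * norm (sample a x - sample a z)"
        unfolding adjoint_measurement_eq_inner inner_diff_right[symmetric] by (rule Cauchy_Schwarz_ineq2)
      also have "\<dots> \<le> B * (e / B)"
        using B \<open>norm (sample a x - sample a z) < e / B\<close> by (intro mult_mono) auto
      also have "\<dots> = e" using B(1) by simp
      finally have "\<bar>?g x - ?g z\<bar> \<le> e" .
      moreover have "\<bar>?g z\<bar> \<le> 1" using q_feasible \<open>z \<in> V k\<close> by (simp add: dual_feasible_iff)
      ultimately show ?thesis by linarith
    qed (use e in auto)
    then show ?case using x(2) order_trans by blast
  qed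
qed

lemma dual_cluster_point:
  assumes s: "strict_mono (s :: nat \<Rightarrow> nat)" and l: "opt_value \<longlonglongrightarrow> l"
  obtains r q' where "strict_mono r" "(\<lambda>k. q (s (r k))) \<longlonglongrightarrow> q'"
    "q' \<in> dual_feasible a unit_cube" "fenchel_conjugate f q' \<le> ereal (- l)"
proof -
  obtain B where B: "\<And>k. norm (q k) \<le> B" by (rule q_bounded) blast
  have "q (s k) \<in> cball 0 B" for k using B by simp
  then obtain q' r where r: "strict_mono (r :: nat \<Rightarrow> nat)" and "((\<lambda>k. q (s k)) \<circ> r) \<longlonglongrightarrow> q'"
    using compact_cball[of 0 B] unfolding compact_def by (metis (no_types, lifting))
  then have lim: "(\<lambda>k. q (s (r k))) \<longlonglongrightarrow> q'" by (simp add: o_def)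
  have "\<bar>adjoint_measurement a q' x\<bar> \<le> 1" if x: "x \<in> unit_cube" for x
  proof (rule field_le_epsilon)
    fix e :: real assume e: "0 < e"
    have "(\<lambda>k. \<bar>adjoint_measurement a (q (s (r k))) x\<bar>) \<longlonglongrightarrow> \<bar>adjoint_measurement a q' x\<bar>"
      unfolding adjoint_measurement_eq_inner using lim by (intro tendsto_intros)
    moreover have "\<forall>\<^sub>F k in sequentially. \<bar>adjoint_measurement a (q (s (r k))) x\<bar> \<le> 1 + e"
      using eventually_subseq[OF strict_mono_o[OF s r] nearly_feasible[OF e]] x
      by (auto simp: o_def elim: eventually_mono)
    ultimately show "\<bar>adjoint_measurement a q' x\<bar> \<le> 1 + e"
      by (intro tendsto_upperbound) auto
  qed
  then have "q' \<in> dual_feasible a unit_cube" by (simp add: dual_feasible_iff)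
  moreover have "fenchel_conjugate f q' \<le> ereal (- l)"
  proof (rule fenchel_conjugate_limit_le[OF minf lim])
    have "(\<lambda>k. - opt_value (s (r k))) \<longlonglongrightarrow> - l"
      by (intro tendsto_minus LIMSEQ_subsubseq[OF l s r])
    then show "(\<lambda>k. fenchel_conjugate f (q (s (r k)))) \<longlonglongrightarrow> ereal (- l)"
      by (simp add: conjugate_eq)
  qed
  ultimately show ?thesis using that r lim by blast
qed

text \<open>
  The chain limit \<open>\<le>\<close> dual value \<open>\<le>\<close> primal value \<open>\<le>\<close> limit, from a dual cluster point, weak duality
  and a primal cluster point.
\<close>

lemma limit_value:
  obtains l where "opt_value \<longlonglongrightarrow> l" "primal_value f a unit_cube = ereal l" "dual_value f a unit_cube = ereal l"
proof -
  obtain l where l: "opt_value \<longlonglongrightarrow> l" by (rule opt_value_convergent) blast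
  then have l': "(\<lambda>k. ereal (opt_value k)) \<longlonglongrightarrow> ereal l" by simp
  obtain \<nu> where \<nu>: "\<nu> \<in> radon_measures unit_cube" "objective f a \<nu> \<le> ereal l"
    by (rule primal_cluster_point[OF strict_mono_id l']) blast
  obtain q' where q': "q' \<in> dual_feasible a unit_cube" "fenchel_conjugate f q' \<le> ereal (- l)"
    by (rule dual_cluster_point[OF strict_mono_id l]) blast
  have "ereal l \<le> - fenchel_conjugate f q'"
    using q'(2) by (cases "fenchel_conjugate f q'") auto
  also have "\<dots> \<le> dual_value f a unit_cube"
    unfolding dual_value_def using q'(1) by (rule SUP_upper)
  finally have 1: "ereal l \<le> dual_value f a unit_cube" .
  have 2: "dual_value f a unit_cube \<le> primal_value f a unit_cube"
    unfolding dual_value_def by (rule SUP_least) (rule weak_duality_unit_cube)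
  have "primal_value f a unit_cube \<le> objective f a \<nu>"
    unfolding primal_value_def using \<nu>(1) by (rule INF_lower)
  with \<nu>(2) have 3: "primal_value f a unit_cube \<le> ereal l" by simp
  show ?thesis
    using that[OF l] antisym[OF 3 order_trans[OF 1 2]] antisym[OF order_trans[OF 2 3] 1] by simp
qed

lemma primal_subsequence:
  assumes s: "strict_mono (s :: nat \<Rightarrow> nat)"
  shows "\<exists>r \<nu>. strict_mono r \<and> primal_solution f a unit_cube \<nu> \<and>
    weak_star_converges unit_cube (\<lambda>k. \<mu> (s (r k))) \<nu> \<and>
    (\<lambda>k. objective f a (\<mu> (s (r k)))) \<longlonglongrightarrow> objective f a \<nu>"
proof -
  obtain l where l: "opt_value \<longlonglongrightarrow> l" and pv: "primal_value f a unit_cube = ereal l" by (rule limit_value)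
  then have l': "(\<lambda>k. ereal (opt_value k)) \<longlonglongrightarrow> ereal l" by simp
  obtain r \<nu> where r: "strict_mono r" and \<nu>: "\<nu> \<in> radon_measures unit_cube" "objective f a \<nu> \<le> ereal l"
    and w: "weak_star_converges unit_cube (\<lambda>k. \<mu> (s (r k))) \<nu>"
    by (rule primal_cluster_point[OF s l'])
  have "primal_value f a unit_cube \<le> objective f a \<nu>"
    unfolding primal_value_def using \<nu>(1) by (rule INF_lower)
  then have obj: "objective f a \<nu> = ereal l" using \<nu>(2) pv by simp
  moreover have "primal_solution f a unit_cube \<nu>" using \<nu>(1) obj pv by (simp add: primal_solution_def)
  moreover have "(\<lambda>k. objective f a (\<mu> (s (r k)))) \<longlonglongrightarrow> ereal l"
    using LIMSEQ_subsubseq[OF l' s r] by (simp only: objective_eq)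
  ultimately show ?thesis using r w by (intro exI[of _ r] exI[of _ \<nu>]) simp
qed

lemma dual_subsequence:
  assumes s: "strict_mono (s :: nat \<Rightarrow> nat)"
  shows "\<exists>r q'. strict_mono r \<and> dual_solution f a unit_cube q' \<and>
    (\<lambda>k. q (s (r k))) \<longlonglongrightarrow> q' \<and>
    (\<lambda>k. fenchel_conjugate f (q (s (r k)))) \<longlonglongrightarrow> fenchel_conjugate f q'"
proof -
  obtain l where l: "opt_value \<longlonglongrightarrow> l" and dv: "dual_value f a unit_cube = ereal l" by (rule limit_value)
  obtain r q' where r: "strict_mono r" and lim: "(\<lambda>k. q (s (r k))) \<longlonglongrightarrow> q'"
    and q': "q' \<in> dual_feasible a unit_cube" "fenchel_conjugate f q' \<le> ereal (- l)"
    by (rule dual_cluster_point[OF s l])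
  have "- fenchel_conjugate f q' \<le> dual_value f a unit_cube"
    unfolding dual_value_def using q'(1) by (rule SUP_upper)
  then have conj: "fenchel_conjugate f q' = ereal (- l)"
    using q'(2) dv by (cases "fenchel_conjugate f q'") auto
  moreover have "dual_solution f a unit_cube q'"
    using q'(1) conj dv by (simp add: dual_solution_def)
  moreover have "(\<lambda>k. fenchel_conjugate f (q (s (r k)))) \<longlonglongrightarrow> ereal (- l)"
    unfolding conjugate_eq using LIMSEQ_subsubseq[OF tendsto_minus[OF l] s r] by simp
  ultimately show ?thesis using r lim by (intro exI[of _ r] exI[of _ q']) simp
qed

lemma primal_unique_converges:
  assumes "\<And>\<nu>. primal_solution f a unit_cube \<nu> \<Longrightarrow> \<nu> = \<mu>'"
  shows "weak_star_converges unit_cube \<mu> \<mu>'"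
  unfolding weak_star_converges_def
proof (intro ballI tendsto_if_subsequences)
  fix \<phi> :: "real^'d \<Rightarrow> real" and s :: "nat \<Rightarrow> nat"
  assume \<phi>: "\<phi> \<in> C0_functions unit_cube" and "strict_mono s"
  from primal_subsequence[OF this(2)] assms
  obtain r where "strict_mono (r :: nat \<Rightarrow> nat)" "weak_star_converges unit_cube (\<lambda>k. \<mu> (s (r k))) \<mu>'"
    by metis
  then show "\<exists>r. strict_mono r \<and>
      (\<lambda>k. signed_integral unit_cube (\<mu> (s (r k))) \<phi>) \<longlonglongrightarrow> signed_integral unit_cube \<mu>' \<phi>"
    using \<phi> unfolding weak_star_converges_def by blast
qed

lemma dual_unique_converges:
  assumes "\<And>z. dual_solution f a unit_cube z \<Longrightarrow> z = q'"
  shows "q \<longlonglongrightarrow> q'"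
  using dual_subsequence assms by (intro tendsto_if_subsequences) metis

end

theorem theorem6:
  fixes f :: "real^'m::finite \<Rightarrow> ereal"
    and a :: "'m \<Rightarrow> real^'d::finite \<Rightarrow> real"
    and \<Omega>0 :: "(real^'d) set set"
  assumes a_C0: "\<And>m. a m \<in> C0_functions unit_cube"
    and f_not_minf: "\<And>y. f y \<noteq> - \<infinity>"
    and f_convex: "ereal_convex f"
    and f_lsc: "lower_semicontinuous f"
    and f_dom: "interior (effective_domain f) \<noteq> {}"
    and coercive: "coercive_objective f a"
    and initial: "cell_partition \<Omega>0"
    and slater: "\<exists>\<mu>\<in>radon_measures (partition_vertices \<Omega>0).
                   measurement a \<mu> \<in> interior (effective_domain f)"
  shows
    "(\<forall>n \<Omega>s Cs \<mu>s qs.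
        \<Omega>s 0 = \<Omega>0 \<and>
        (\<forall>k<n. refinement_step f a (\<Omega>s k) (\<mu>s k) (qs k) (Cs k) (\<Omega>s (Suc k)) \<and>
               large_local_maximizers a (qs k) \<subseteq> \<Union>(Cs k)) \<longrightarrow>
        (\<exists>\<mu>. primal_solution f a (partition_vertices (\<Omega>s n)) \<mu>) \<and>
        (\<exists>q. dual_solution f a (partition_vertices (\<Omega>s n)) q)) \<and>
     (\<forall>\<Omega>s Cs \<mu>s qs.
        \<Omega>s 0 = \<Omega>0 \<and>
        (\<forall>k. refinement_step f a (\<Omega>s k) (\<mu>s k) (qs k) (Cs k) (\<Omega>s (Suc k)) \<and>
             large_local_maximizers a (qs k) \<subseteq> \<Union>(Cs k)) \<longrightarrow>
        (\<exists>r \<mu>. strict_mono r \<and> primal_solution f a unit_cube \<mu> \<and>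
           weak_star_converges unit_cube (\<lambda>k. \<mu>s (r k)) \<mu> \<and>
           (\<lambda>k. objective f a (\<mu>s (r k))) \<longlonglongrightarrow> objective f a \<mu>) \<and>
        (\<exists>r q. strict_mono r \<and> dual_solution f a unit_cube q \<and>
           (\<lambda>k. qs (r k)) \<longlonglongrightarrow> q \<and>
           (\<lambda>k. fenchel_conjugate f (qs (r k))) \<longlonglongrightarrow> fenchel_conjugate f q) \<and>
        (\<forall>\<mu>. primal_solution f a unit_cube \<mu> \<and>
             (\<forall>\<nu>. primal_solution f a unit_cube \<nu> \<longrightarrow> \<nu> = \<mu>) \<longrightarrow>
           weak_star_converges unit_cube \<mu>s \<mu>) \<and>
        (\<forall>q. dual_solution f a unit_cube q \<and>
             (\<forall>p. dual_solution f a unit_cube p \<longrightarrow> p = q) \<longrightarrow>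
           qs \<longlonglongrightarrow> q))"
proof -
  interpret measurement_problem f a
    using a_C0 f_not_minf f_convex f_lsc coercive
    by unfold_locales (auto simp: C0_functions_def)
  have \<Omega>0: "finite \<Omega>0" "\<Omega>0 \<subseteq> dyadic_cells" using initial by (auto simp: cell_partition_def)
  obtain \<mu>0 where \<mu>0: "\<mu>0 \<in> radon_measures (partition_vertices \<Omega>0)"
      "measurement a \<mu>0 \<in> interior (effective_domain f)"
    using slater by blast
  have solvable: "(\<exists>\<mu>. primal_solution f a (partition_vertices (\<Omega>s n)) \<mu>) \<and>
      (\<exists>q. dual_solution f a (partition_vertices (\<Omega>s n)) q)"
    if "\<Omega>s 0 = \<Omega>0" "\<forall>k<n. refinement_step f a (\<Omega>s k) (\<mu>s k) (qs k) (Cs k) (\<Omega>s (Suc k))"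
    for n \<Omega>s Cs and \<mu>s :: "nat \<Rightarrow> (real^'d) set \<Rightarrow> real" and qs
  proof -
    have inv: "finite (\<Omega>s n) \<and> \<Omega>s n \<subseteq> dyadic_cells \<and>
        partition_vertices (\<Omega>s 0) \<subseteq> partition_vertices (\<Omega>s n)"
      using \<Omega>0 that by (intro refinement_invariants[where C=Cs and n=n]) (auto simp: refinement_step_def)
    then have V: "finite (partition_vertices (\<Omega>s n))" "partition_vertices (\<Omega>s n) \<subseteq> unit_cube"
      using partition_vertices_finite_subset by blast+
    have \<mu>0': "\<mu>0 \<in> radon_measures (partition_vertices (\<Omega>s n))"
      using inv that(1) \<mu>0(1) radon_measures_mono by blast
    show ?thesis
      using finite_primal_solution_exists[OF V] finite_duality[OF V \<mu>0' \<mu>0(2)] by metis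
  qed
  have run: "refinement_run f a \<Omega>s Cs \<mu>s qs \<mu>0"
    if "\<Omega>s 0 = \<Omega>0" "\<forall>k. refinement_step f a (\<Omega>s k) (\<mu>s k) (qs k) (Cs k) (\<Omega>s (Suc k)) \<and>
      large_local_maximizers a (qs k) \<subseteq> \<Union>(Cs k)" for \<Omega>s Cs \<mu>s qs
    using that \<Omega>0 \<mu>0 by unfold_locales auto
  show ?thesis
  proof (intro conjI allI impI; elim conjE)
    fix n \<Omega>s Cs qs and \<mu>s :: "nat \<Rightarrow> (real^'d) set \<Rightarrow> real"
    assume "\<Omega>s 0 = \<Omega>0"
      "\<forall>k<n. refinement_step f a (\<Omega>s k) (\<mu>s k) (qs k) (Cs k) (\<Omega>s (Suc k)) \<and>
        large_local_maximizers a (qs k) \<subseteq> \<Union>(Cs k)"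
    then show "\<exists>\<mu>. primal_solution f a (partition_vertices (\<Omega>s n)) \<mu>"
      "\<exists>q. dual_solution f a (partition_vertices (\<Omega>s n)) q"
      using solvable[of \<Omega>s n \<mu>s qs Cs] by blast+
  next
    fix \<Omega>s Cs \<mu>s qs
    assume *: "\<Omega>s 0 = \<Omega>0"
      "\<forall>k. refinement_step f a (\<Omega>s k) (\<mu>s k) (qs k) (Cs k) (\<Omega>s (Suc k)) \<and>
        large_local_maximizers a (qs k) \<subseteq> \<Union>(Cs k)"
    interpret refinement_run f a \<Omega>s Cs \<mu>s qs \<mu>0 by (rule run[OF *])
    show "\<exists>r \<mu>. strict_mono r \<and> primal_solution f a unit_cube \<mu> \<and>
        weak_star_converges unit_cube (\<lambda>k. \<mu>s (r k)) \<mu> \<and>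
        (\<lambda>k. objective f a (\<mu>s (r k))) \<longlonglongrightarrow> objective f a \<mu>"
      using primal_subsequence[OF strict_mono_id] by simp
    show "\<exists>r q. strict_mono r \<and> dual_solution f a unit_cube q \<and> (\<lambda>k. qs (r k)) \<longlonglongrightarrow> q \<and>
        (\<lambda>k. fenchel_conjugate f (qs (r k))) \<longlonglongrightarrow> fenchel_conjugate f q"
      using dual_subsequence[OF strict_mono_id] by simp
    show "weak_star_converges unit_cube \<mu>s \<mu>"
      if "\<forall>\<nu>. primal_solution f a unit_cube \<nu> \<longrightarrow> \<nu> = \<mu>" for \<mu>
      using that primal_unique_converges by blast
    show "qs \<longlonglongrightarrow> q" if "\<forall>p. dual_solution f a unit_cube p \<longrightarrow> p = q" for q
      using that dual_unique_converges by blast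
  qed
qed

end
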